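(* For symmetric quiver algebras of finite representation type, the equivalence $\le_{\deg}\Longleftrightarrow\le_{\deg}^{\varepsilon}$ on $R(\mathcal{A},V)^{\langle-,-\rangle,\varepsilon}$ is not true in general. That is, there exist a symmetric quiver algebra $(\mathcal{A},\sigma)$ of finite representation type over $\mathbb{C}$, a sign $\varepsilon\in\{\pm1\}$, an $\varepsilon$-quadratic space $(V,\langle-,-\rangle)$ for $(\mathcal{A},\sigma)$, and $M,N\in R(\mathcal{A},V)^{\langle-,-\rangle,\varepsilon}$ such that $M\le_{\deg}N$ but not $M\le_{\deg}^{\varepsilon}N$.
   Context: The base field is $\mathrm{k}=\mathbb{C}$; closures are Zariski closures. A symmetric quiver $(\mathcal{Q},\sigma)$ is a finite quiver $\mathcal{Q}=(\mathcal{Q}_0,\mathcal{Q}_1,s,t)$ with an involution $\sigma$ of $\mathcal{Q}_0$ together with an arrow-reversing involution of $\mathcal{Q}_1$, also denoted $\sigma$ (so $\sigma(\alpha):\sigma(j)\to\sigma(i)$ for $\alpha:i\to j$). An ideal $I\subseteq\mathrm{k}\mathcal{Q}$ of the path algebra is admissible if $R^s\subseteq I\subseteq R^2$ for some integer $s$, where $R$ is the two-sided ideal generated by all arrows. A symmetric quiver algebra is a pair $(\mathcal{A}=\mathrm{k}\mathcal{Q}/I,\sigma)$ with $(\mathcal{Q},\sigma)$ a symmetric quiver and $I$ an admissible ideal such that $\sigma(I)=I$. It is of finite representation type if it has only finitely many isomorphism classes of finite-dimensional indecomposable modules (so that every $R(\mathcal{A},V)$ has only finitely many $\mathrm{GL}^\bullet(V)$-orbits).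 For a finite-dimensional $\mathcal{Q}_0$-graded vector space $V=\bigoplus_iV_i$, $R(\mathcal{A},V)$ is the variety of tuples of linear maps $(f_\alpha:V_{s(\alpha)}\to V_{t(\alpha)})_{\alpha\in\mathcal{Q}_1}$ satisfying the relations in $I$. The group $\mathrm{GL}^\bullet(V)=\prod_i\mathrm{GL}(V_i)$ acts by $(g\cdot M)_\alpha=g_{t(\alpha)}M_\alpha g_{s(\alpha)}^{-1}$. A representation is viewed as an endomorphism of $V$ (the sum of its maps). An $\varepsilon$-quadratic space for $(\mathcal{A},\sigma)$ is a pair $(V,\langle-,-\rangle)$, where $V$ is a finite-dimensional $\mathcal{Q}_0$-graded vector space and $\langle-,-\rangle$ is a non-degenerate bilinear form on $V$ with $\langle v,w\rangle=\varepsilon\langle w,v\rangle$ for all $v,w$ and $\langle V_i,V_j\rangle=0$ whenever $j\ne\sigma(i)$. Then $R(\mathcal{A},V)^{\langle-,-\rangle,\varepsilon}$ is the set of $M\in R(\mathcal{A},V)$ with $\langle Mv,w\rangle+\langle v,Mw\rangle=0$ for all $v,w\in V$, and $\mathrm{G}^\bullet(V,\langle-,-\rangle)$ is the group of those $g\in\mathrm{GL}^\bullet(V)$ which are isometries of the form; it acts on $R(\mathcal{A},V)^{\langle-,-\rangle,\varepsilon}$. For $M,N\in R(\mathcal{A},V)^{\langle-,-\rangle,\varepsilon}$: $M\le_{\deg}N$ means $N\in\overline{\mathrm{GL}^\bullet(V)\cdot M}$, and $M\le_{\deg}^{\varepsilon}N$ means $N\in\overline{\mathrm{G}^\bullet(V,\langle-,-\rangle)\cdot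 M}$. *)

theory Defs
  imports
    "HOL-Algebra.Ideal_Product"
    "HOL-Library.FuncSet"
    "HOL.Hull"
    "Graph_Theory.Arc_Walk"
    "Jordan_Normal_Form.Matrix"
begin

section \<open>Path algebras of finite quivers\<close>

text \<open>
  A finite quiver is a \<open>fin_digraph\<close> (loops and parallel arrows are allowed); the arrow \<open>a\<close> goes
  from \<open>tail Q a\<close> to \<open>head Q a\<close>. A path is a pair \<open>(u, p)\<close> of its starting vertex and the list of
  its arrows in the order in which they are traversed; \<open>(u, [])\<close> is the trivial path at \<open>u\<close>.
\<close>

type_synonym ('v, 'a) path = "'v \<times> 'a list"

definition paths :: "('v, 'a) pre_digraph \<Rightarrow> ('v, 'a) path set" where
  "paths Q = {(u, p). \<exists>v. pre_digraph.awalk Q u p v}"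

text \<open>
  The product is composition of maps: \<open>f * g\<close> means first \<open>g\<close>, then \<open>f\<close>. The coefficient of the
  product at \<open>(u, p)\<close> is the sum over all ways of cutting \<open>p\<close> into an initial part (belonging to
  \<open>g\<close>) and a final part (belonging to \<open>f\<close>).
\<close>

definition path_mult ::
  "('v, 'a) pre_digraph \<Rightarrow> (('v, 'a) path \<Rightarrow> complex) \<Rightarrow> (('v, 'a) path \<Rightarrow> complex)
    \<Rightarrow> ('v, 'a) path \<Rightarrow> complex" where
  "path_mult Q f g = (\<lambda>(u, p). \<Sum>k\<le>length p.
     f (pre_digraph.awlast Q u (take k p), drop k p) * g (u, take k p))"

definition path_algebra :: "('v, 'a) pre_digraph \<Rightarrow> (('v, 'a) path \<Rightarrow> complex) ring" where
  "path_algebra Q =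
    \<lparr> carrier = {f. finite {x. f x \<noteq> 0} \<and> {x. f x \<noteq> 0} \<subseteq> paths Q},
      monoid.mult = path_mult Q,
      one = (\<lambda>(u, p). if u \<in> verts Q \<and> p = [] then 1 else 0),
      zero = (\<lambda>_. 0),
      add = (\<lambda>f g x. f x + g x) \<rparr>"

text \<open>The locale \<open>ideal\<close> used below includes that \<open>path_algebra Q\<close> is a ring.\<close>

lemma awlast_if: "pre_digraph.awlast Q u p = (if p = [] then u else head Q (last p))"
  by (simp add: pre_digraph.awalk_verts_conv)

lemma cas_append: "pre_digraph.cas Q u (p @ q) w \<longleftrightarrow> (\<exists>v. pre_digraph.cas Q u p v \<and> pre_digraph.cas Q v q w)"
  by (induct p arbitrary: u) (auto simp: pre_digraph.cas.simps)

lemma cas_awlast: "pre_digraph.cas Q u p v \<Longrightarrow> pre_digraph.awlast Q u p = v"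
  by (induct p arbitrary: u) (auto simp: pre_digraph.cas.simps awlast_if split: if_splits)

lemma paths_append:
  assumes "(u, p) \<in> paths Q" "(pre_digraph.awlast Q u p, q) \<in> paths Q"
  shows "(u, p @ q) \<in> paths Q"
proof -
  obtain v where v: "u \<in> verts Q" "set p \<subseteq> arcs Q" "pre_digraph.cas Q u p v"
    using assms(1) by (auto simp: paths_def pre_digraph.awalk_def)
  obtain w where "set q \<subseteq> arcs Q" "pre_digraph.cas Q v q w"
    using assms(2) cas_awlast[OF v(3)] by (auto simp: paths_def pre_digraph.awalk_def)
  moreover from this v have "pre_digraph.cas Q u (p @ q) w" by (auto simp: cas_append)
  ultimately show ?thesis using v by (auto simp: paths_def pre_digraph.awalk_def)
qed

lemma path_mult_closed:
  assumes f: "finite {x. f x \<noteq> 0}" "{x. f x \<noteq> 0} \<subseteq> paths Q"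
    and g: "finite {x. g x \<noteq> 0}" "{x. g x \<noteq> 0} \<subseteq> paths Q"
  shows "finite {x. path_mult Q f g x \<noteq> 0} \<and> {x. path_mult Q f g x \<noteq> 0} \<subseteq> paths Q"
proof -
  have *: "\<exists>q r. p = q @ r \<and> f (pre_digraph.awlast Q u q, r) \<noteq> 0 \<and> g (u, q) \<noteq> 0"
    if nz: "path_mult Q f g (u, p) \<noteq> 0" for u p
  proof -
    obtain k where "f (pre_digraph.awlast Q u (take k p), drop k p) * g (u, take k p) \<noteq> 0"
      using nz unfolding path_mult_def prod.case by (meson sum.neutral)
    then show ?thesis by (intro exI[of _ "take k p"] exI[of _ "drop k p"]) auto
  qed
  have "{x. path_mult Q f g x \<noteq> 0} \<subseteq>
      (\<lambda>(x, y). (fst y, snd y @ snd x)) ` ({x. f x \<noteq> 0} \<times> {x. g x \<noteq> 0})"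
    using * by (force simp: image_iff)
  moreover have "{x. path_mult Q f g x \<noteq> 0} \<subseteq> paths Q"
    using * f(2) g(2) by (fastforce intro: paths_append)
  ultimately show ?thesis using f(1) g(1) by (meson finite_SigmaI finite_imageI finite_subset)
qed

lemma path_mult_assoc: "path_mult Q (path_mult Q f g) h = path_mult Q f (path_mult Q g h)"
proof (rule ext, clarify)
  fix u and p :: "'b list"
  let ?l = "pre_digraph.awlast Q"
  let ?n = "length p"
  let ?t = "\<lambda>j k. f (?l u (take k p), drop k p) * g (?l u (take j p), drop j (take k p)) * h (u, take j p)"
  have l: "?l (?l u (take j p)) (take m (drop j p)) = ?l u (take (j + m) p)" for j m
    by (simp add: awlast_if take_add)
  have L: "(\<Sum>m\<le>?n - j. f (?l u (take (j + m) p), drop (m + j) p) * g (?l u (take j p), take m (drop j p)) * h (u, take j p))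
      = (\<Sum>k\<in>{j..?n}. ?t j k)" if "j \<le> ?n" for j
    by (rule sum.reindex_bij_witness[of _ "\<lambda>k. k - j" "\<lambda>m. m + j"])
       (use that in \<open>auto simp: add.commute take_drop\<close>)
  have "path_mult Q (path_mult Q f g) h (u, p) = (\<Sum>j\<le>?n. \<Sum>k\<in>{j..?n}. ?t j k)"
    unfolding path_mult_def prod.case
  proof (intro sum.cong refl)
    fix j assume "j \<in> {..?n}"
    then have j: "j \<le> ?n" by simp
    show "(\<Sum>m\<le>length (drop j p). f (?l (?l u (take j p)) (take m (drop j p)), drop m (drop j p)) *
        g (?l u (take j p), take m (drop j p))) * h (u, take j p) = (\<Sum>k\<in>{j..?n}. ?t j k)"
      unfolding L[OF j, symmetric] l sum_distrib_right drop_drop length_drop ..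
  qed
  also have "\<dots> = (\<Sum>k\<le>?n. \<Sum>j\<le>k. ?t j k)"
    by (subst (1 2) sum.Sigma, simp, simp, simp, simp,
        rule sum.reindex_bij_witness[of _ prod.swap prod.swap]) auto
  also have "\<dots> = path_mult Q f (path_mult Q g h) (u, p)"
    unfolding path_mult_def prod.case
  proof (intro sum.cong refl)
    fix k assume "k \<in> {..?n}"
    then have k: "length (take k p) = k" by simp
    show "(\<Sum>j\<le>k. ?t j k) = f (?l u (take k p), drop k p) *
        (\<Sum>j\<le>length (take k p). g (?l u (take j (take k p)), drop j (take k p)) * h (u, take j (take k p)))"
      unfolding k sum_distrib_left by (intro sum.cong refl) (simp add: min_def mult.assoc)
  qed
  finally show "path_mult Q (path_mult Q f g) h (u, p) = path_mult Q f (path_mult Q g h) (u, p)" .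
qed

lemma path_mult_one_right:
  assumes "{x. f x \<noteq> 0} \<subseteq> paths Q"
  shows "path_mult Q f (\<lambda>(u, p). if u \<in> verts Q \<and> p = [] then 1 else 0) = f"
proof (rule ext, clarify)
  fix u and p :: "'b list"
  have 0: "u \<notin> verts Q \<Longrightarrow> f (u, p) = 0"
    using assms by (force simp: paths_def pre_digraph.awalk_def)
  have "path_mult Q f (\<lambda>(u, p). if u \<in> verts Q \<and> p = [] then 1 else 0) (u, p)
     = (\<Sum>k\<le>length p. if k = 0 then (if u \<in> verts Q then f (u, p) else 0) else 0)"
    unfolding path_mult_def prod.case by (intro sum.cong refl) (auto simp: awlast_if)
  also have "\<dots> = f (u, p)" using 0 by (simp add: sum.delta)
  finally show "path_mult Q f (\<lambda>(u, p). if u \<in> verts Q \<and> p = [] then 1 else 0) (u, p) = f (u, p)" .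
qed

lemma path_mult_one_left:
  assumes "fin_digraph Q" "{x. f x \<noteq> 0} \<subseteq> paths Q"
  shows "path_mult Q (\<lambda>(u, p). if u \<in> verts Q \<and> p = [] then 1 else 0) f = f"
proof (rule ext, clarify)
  interpret fin_digraph Q by fact
  fix u and p :: "'b list"
  have 0: "f (u, p) \<noteq> 0 \<Longrightarrow> awlast u p \<in> verts Q"
  proof -
    assume "f (u, p) \<noteq> 0"
    then have "(u, p) \<in> paths Q" using assms(2) by auto
    then show ?thesis by (auto simp: paths_def)
  qed
  have "path_mult Q (\<lambda>(u, p). if u \<in> verts Q \<and> p = [] then 1 else 0) f (u, p)
     = (\<Sum>k\<le>length p. if k = length p then (if awlast u p \<in> verts Q then f (u, p) else 0) else 0)"
    unfolding path_mult_def prod.case by (intro sum.cong refl) auto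
  also have "\<dots> = f (u, p)" using 0 by (auto simp: sum.delta)
  finally show "path_mult Q (\<lambda>(u, p). if u \<in> verts Q \<and> p = [] then 1 else 0) f (u, p) = f (u, p)" .
qed

lemma ring_path_algebra:
  assumes "fin_digraph Q"
  shows "ring (path_algebra Q)"
proof -
  have add: "finite {x. f x + g x \<noteq> 0} \<and> {x. f x + g x \<noteq> 0} \<subseteq> paths Q"
    if "finite {x. f x \<noteq> 0}" "{x. f x \<noteq> 0} \<subseteq> paths Q" "finite {x. g x \<noteq> 0}" "{x. g x \<noteq> 0} \<subseteq> paths Q"
    for f g :: "('a, 'b) path \<Rightarrow> complex"
  proof -
    have "{x. f x + g x \<noteq> 0} \<subseteq> {x. f x \<noteq> 0} \<union> {x. g x \<noteq> 0}" by auto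
    then show ?thesis using that by (meson finite_Un finite_subset le_sup_iff order_trans)
  qed
  show ?thesis
  proof (rule ringI)
    show "abelian_group (path_algebra Q)"
    proof (rule abelian_groupI)
      fix f assume f: "f \<in> carrier (path_algebra Q)"
      then show "\<exists>g\<in>carrier (path_algebra Q). g \<oplus>\<^bsub>path_algebra Q\<^esub> f = \<zero>\<^bsub>path_algebra Q\<^esub>"
        by (intro bexI[of _ "\<lambda>x. - f x"]) (auto simp: path_algebra_def)
    qed (use add in \<open>auto simp: path_algebra_def algebra_simps\<close>)
    show "Group.monoid (path_algebra Q)"
    proof (rule Group.monoidI)
      have "finite (verts Q)" using assms by (rule fin_digraph.finite_verts)
      then have "finite (verts Q \<times> {[]::'b list})" by simp
      moreover have "{x. (\<lambda>(u, p). if u \<in> verts Q \<and> p = ([]::'b list) then 1 else 0::complex) x \<noteq> 0} = verts Q \<times> {[]}"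
        by (auto split: if_splits)
      moreover have "verts Q \<times> {[]} \<subseteq> paths Q"
        by (auto simp: paths_def pre_digraph.awalk_def pre_digraph.cas.simps)
      ultimately show "\<one>\<^bsub>path_algebra Q\<^esub> \<in> carrier (path_algebra Q)"
        by (simp add: path_algebra_def)
    next
      fix f g assume "f \<in> carrier (path_algebra Q)" "g \<in> carrier (path_algebra Q)"
      then show "f \<otimes>\<^bsub>path_algebra Q\<^esub> g \<in> carrier (path_algebra Q)"
        using path_mult_closed[of f Q g] by (simp add: path_algebra_def)
    next
      fix f assume "f \<in> carrier (path_algebra Q)"
      then have "{x. f x \<noteq> 0} \<subseteq> paths Q" by (simp add: path_algebra_def)
      then show "f \<otimes>\<^bsub>path_algebra Q\<^esub> \<one>\<^bsub>path_algebra Q\<^esub> = f"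
        "\<one>\<^bsub>path_algebra Q\<^esub> \<otimes>\<^bsub>path_algebra Q\<^esub> f = f"
        unfolding path_algebra_def by (simp_all only: monoid.simps path_mult_one_right path_mult_one_left[OF assms])
    qed (simp add: path_algebra_def path_mult_assoc)
  qed (simp_all add: path_algebra_def path_mult_def algebra_simps sum.distrib fun_eq_iff)
qed

definition arrow_elem :: "('v, 'a) pre_digraph \<Rightarrow> 'a \<Rightarrow> ('v, 'a) path \<Rightarrow> complex" where
  "arrow_elem Q a = (\<lambda>x. if x = (tail Q a, [a]) then 1 else 0)"

definition arrow_ideal :: "('v, 'a) pre_digraph \<Rightarrow> (('v, 'a) path \<Rightarrow> complex) set" where
  "arrow_ideal Q = Idl\<^bsub>path_algebra Q\<^esub> (arrow_elem Q ` arcs Q)"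

definition admissible_ideal ::
  "('v, 'a) pre_digraph \<Rightarrow> (('v, 'a) path \<Rightarrow> complex) set \<Rightarrow> bool" where
  "admissible_ideal Q I \<longleftrightarrow>
     ideal I (path_algebra Q) \<and>
     (\<exists>s::nat. arrow_ideal Q [^]\<^bsub>ideals_set (path_algebra Q)\<^esub> s \<subseteq> I) \<and>
     I \<subseteq> arrow_ideal Q [^]\<^bsub>ideals_set (path_algebra Q)\<^esub> (2::nat)"


section \<open>Symmetric quiver algebras\<close>

definition symmetric_quiver ::
  "('v, 'a) pre_digraph \<Rightarrow> ('v \<Rightarrow> 'v) \<Rightarrow> ('a \<Rightarrow> 'a) \<Rightarrow> bool" where
  "symmetric_quiver Q \<sigma>0 \<sigma>1 \<longleftrightarrow>
     fin_digraph Q \<and>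
     (\<forall>i\<in>verts Q. \<sigma>0 i \<in> verts Q \<and> \<sigma>0 (\<sigma>0 i) = i) \<and>
     (\<forall>a\<in>arcs Q. \<sigma>1 a \<in> arcs Q \<and> \<sigma>1 (\<sigma>1 a) = a \<and>
        tail Q (\<sigma>1 a) = \<sigma>0 (head Q a) \<and> head Q (\<sigma>1 a) = \<sigma>0 (tail Q a))"

definition path_sigma ::
  "('v, 'a) pre_digraph \<Rightarrow> ('v \<Rightarrow> 'v) \<Rightarrow> ('a \<Rightarrow> 'a) \<Rightarrow> ('v, 'a) path \<Rightarrow> ('v, 'a) path" where
  "path_sigma Q \<sigma>0 \<sigma>1 = (\<lambda>(u, p). (\<sigma>0 (pre_digraph.awlast Q u p), rev (map \<sigma>1 p)))"

text \<open>
  The linear extension of \<open>path_sigma\<close> to the path algebra. As \<open>path_sigma\<close> is an involution on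
  paths, the coefficient of \<open>\<sigma>(f)\<close> at a path is the coefficient of \<open>f\<close> at its image.
\<close>

definition algebra_sigma ::
  "('v, 'a) pre_digraph \<Rightarrow> ('v \<Rightarrow> 'v) \<Rightarrow> ('a \<Rightarrow> 'a)
    \<Rightarrow> (('v, 'a) path \<Rightarrow> complex) \<Rightarrow> ('v, 'a) path \<Rightarrow> complex" where
  "algebra_sigma Q \<sigma>0 \<sigma>1 f = (\<lambda>x. if x \<in> paths Q then f (path_sigma Q \<sigma>0 \<sigma>1 x) else 0)"

definition symmetric_quiver_algebra ::
  "('v, 'a) pre_digraph \<Rightarrow> (('v, 'a) path \<Rightarrow> complex) set \<Rightarrow> ('v \<Rightarrow> 'v) \<Rightarrow> ('a \<Rightarrow> 'a) \<Rightarrow> bool" where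
  "symmetric_quiver_algebra Q I \<sigma>0 \<sigma>1 \<longleftrightarrow>
     symmetric_quiver Q \<sigma>0 \<sigma>1 \<and> admissible_ideal Q I \<and> algebra_sigma Q \<sigma>0 \<sigma>1 ` I = I"


section \<open>Representations\<close>

text \<open>
  The graded vector space \<open>V\<close> with dimension vector \<open>d\<close> is the direct sum of the spaces
  \<open>V\<^sub>i = \<complex>\<^bsup>d i\<^esup>\<close>. \<open>rep_tuples\<close> is the affine space of all tuples of linear maps, whether or not they
  satisfy relations; \<open>rep_variety\<close> is \<open>R(A,V)\<close>.
\<close>

definition rep_tuples ::
  "('v, 'a) pre_digraph \<Rightarrow> ('v \<Rightarrow> nat) \<Rightarrow> ('a \<Rightarrow> complex mat) set" where
  "rep_tuples Q d = (\<Pi>\<^sub>E a\<in>arcs Q. carrier_mat (d (head Q a)) (d (tail Q a)))"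

primrec path_mat ::
  "('v, 'a) pre_digraph \<Rightarrow> ('v \<Rightarrow> nat) \<Rightarrow> ('a \<Rightarrow> complex mat) \<Rightarrow> 'v \<Rightarrow> 'a list \<Rightarrow> complex mat" where
  "path_mat Q d M u [] = 1\<^sub>m (d u)"
| "path_mat Q d M u (a # p) = path_mat Q d M (head Q a) p * M a"

text \<open>
  An element \<open>\<rho>\<close> of the path algebra acts by zero on \<open>V\<close> iff for all vertices \<open>u\<close>, \<open>v\<close> its
  component \<open>V\<^sub>u \<rightarrow> V\<^sub>v\<close>, a linear combination of the path matrices from \<open>u\<close> to \<open>v\<close>, vanishes.
\<close>

definition satisfies_relation ::
  "('v, 'a) pre_digraph \<Rightarrow> ('v \<Rightarrow> nat) \<Rightarrow> ('a \<Rightarrow> complex mat) \<Rightarrow> (('v, 'a) path \<Rightarrow> complex) \<Rightarrow> bool" where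
  "satisfies_relation Q d M \<rho> \<longleftrightarrow>
     (\<forall>u\<in>verts Q. \<forall>v\<in>verts Q. \<forall>i<d v. \<forall>j<d u.
        (\<Sum>p\<in>{p. \<rho> (u, p) \<noteq> 0 \<and> pre_digraph.awalk Q u p v}.
           \<rho> (u, p) * path_mat Q d M u p $$ (i, j)) = 0)"

definition rep_variety ::
  "('v, 'a) pre_digraph \<Rightarrow> (('v, 'a) path \<Rightarrow> complex) set \<Rightarrow> ('v \<Rightarrow> nat) \<Rightarrow> ('a \<Rightarrow> complex mat) set" where
  "rep_variety Q I d = {M \<in> rep_tuples Q d. \<forall>\<rho>\<in>I. satisfies_relation Q d M \<rho>}"

abbreviation mat_ring :: "nat \<Rightarrow> complex mat ring" where
  "mat_ring n \<equiv> ring_mat TYPE(complex) n ()"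

definition GL_bullet :: "('v, 'a) pre_digraph \<Rightarrow> ('v \<Rightarrow> nat) \<Rightarrow> ('v \<Rightarrow> complex mat) set" where
  "GL_bullet Q d = (\<Pi>\<^sub>E i\<in>verts Q. Units (mat_ring (d i)))"

definition act ::
  "('v, 'a) pre_digraph \<Rightarrow> ('v \<Rightarrow> nat) \<Rightarrow> ('v \<Rightarrow> complex mat) \<Rightarrow> ('a \<Rightarrow> complex mat)
    \<Rightarrow> 'a \<Rightarrow> complex mat" where
  "act Q d g M = (\<lambda>a\<in>arcs Q.
     g (head Q a) * M a * (inv\<^bsub>mat_ring (d (tail Q a))\<^esub> (g (tail Q a))))"


section \<open>Finite representation type\<close>

text \<open>
  Finite-dimensional modules over \<open>A = kQ/I\<close> are representations of \<open>Q\<close> satisfying \<open>I\<close>, that is,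
  pairs \<open>(d, M)\<close> of a dimension vector and a point of \<open>R(A,V)\<close>. Only the values of \<open>d\<close> on vertices
  matter.
\<close>

type_synonym ('v, 'a) rep = "('v \<Rightarrow> nat) \<times> ('a \<Rightarrow> complex mat)"

definition reps ::
  "('v, 'a) pre_digraph \<Rightarrow> (('v, 'a) path \<Rightarrow> complex) set \<Rightarrow> ('v, 'a) rep set" where
  "reps Q I = {(d, M). M \<in> rep_variety Q I d}"

definition rep_iso :: "('v, 'a) pre_digraph \<Rightarrow> (('v, 'a) rep \<times> ('v, 'a) rep) set" where
  "rep_iso Q = {((d, M), (e, N)). (\<forall>i\<in>verts Q. d i = e i) \<and> (\<exists>g\<in>GL_bullet Q d. N = act Q d g M)}"

definition zero_rep :: "('v, 'a) pre_digraph \<Rightarrow> ('v, 'a) rep \<Rightarrow> bool" where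
  "zero_rep Q X \<longleftrightarrow> (\<forall>i\<in>verts Q. fst X i = 0)"

definition rep_sum ::
  "('v, 'a) pre_digraph \<Rightarrow> ('v, 'a) rep \<Rightarrow> ('v, 'a) rep \<Rightarrow> ('v, 'a) rep" where
  "rep_sum Q = (\<lambda>(d, M) (e, N).
     (\<lambda>i. d i + e i,
      \<lambda>a\<in>arcs Q. four_block_mat (M a) (0\<^sub>m (d (head Q a)) (e (tail Q a)))
                                (0\<^sub>m (e (head Q a)) (d (tail Q a))) (N a)))"

definition indecomposables ::
  "('v, 'a) pre_digraph \<Rightarrow> (('v, 'a) path \<Rightarrow> complex) set \<Rightarrow> ('v, 'a) rep set" where
  "indecomposables Q I = {X \<in> reps Q I. \<not> zero_rep Q X \<and>
     \<not> (\<exists>Y\<in>reps Q I. \<exists>Z\<in>reps Q I.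
          \<not> zero_rep Q Y \<and> \<not> zero_rep Q Z \<and> (X, rep_sum Q Y Z) \<in> rep_iso Q)}"

definition finite_rep_type ::
  "('v, 'a) pre_digraph \<Rightarrow> (('v, 'a) path \<Rightarrow> complex) set \<Rightarrow> bool" where
  "finite_rep_type Q I \<longleftrightarrow>
     finite (indecomposables Q I // (rep_iso Q \<inter> indecomposables Q I \<times> indecomposables Q I))"


section \<open>Quadratic spaces and symmetric representations\<close>

definition graded_space ::
  "('v, 'a) pre_digraph \<Rightarrow> ('v \<Rightarrow> nat) \<Rightarrow> ('v \<Rightarrow> complex vec) set" where
  "graded_space Q d = (\<Pi>\<^sub>E i\<in>verts Q. carrier_vec (d i))"

definition graded_zero :: "('v, 'a) pre_digraph \<Rightarrow> ('v \<Rightarrow> nat) \<Rightarrow> 'v \<Rightarrow> complex vec" where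
  "graded_zero Q d = (\<lambda>i\<in>verts Q. 0\<^sub>v (d i))"

definition graded_add ::
  "('v, 'a) pre_digraph \<Rightarrow> ('v \<Rightarrow> complex vec) \<Rightarrow> ('v \<Rightarrow> complex vec) \<Rightarrow> 'v \<Rightarrow> complex vec" where
  "graded_add Q v w = (\<lambda>i\<in>verts Q. v i + w i)"

definition graded_smult ::
  "('v, 'a) pre_digraph \<Rightarrow> complex \<Rightarrow> ('v \<Rightarrow> complex vec) \<Rightarrow> 'v \<Rightarrow> complex vec" where
  "graded_smult Q c v = (\<lambda>i\<in>verts Q. c \<cdot>\<^sub>v v i)"

definition graded_component ::
  "('v, 'a) pre_digraph \<Rightarrow> ('v \<Rightarrow> nat) \<Rightarrow> 'v \<Rightarrow> ('v \<Rightarrow> complex vec) set" where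
  "graded_component Q d i = {v \<in> graded_space Q d. \<forall>j\<in>verts Q. j \<noteq> i \<longrightarrow> v j = 0\<^sub>v (d j)}"

type_synonym 'v form = "('v \<Rightarrow> complex vec) \<Rightarrow> ('v \<Rightarrow> complex vec) \<Rightarrow> complex"

definition bilinear_form :: "('v, 'a) pre_digraph \<Rightarrow> ('v \<Rightarrow> nat) \<Rightarrow> 'v form \<Rightarrow> bool" where
  "bilinear_form Q d B \<longleftrightarrow>
     (\<forall>u\<in>graded_space Q d. \<forall>v\<in>graded_space Q d. \<forall>w\<in>graded_space Q d. \<forall>c.
        B (graded_add Q u v) w = B u w + B v w \<and>
        B w (graded_add Q u v) = B w u + B w v \<and>
        B (graded_smult Q c v) w = c * B v w \<and>
        B w (graded_smult Q c v) = c * B w v)"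

definition quadratic_space ::
  "('v, 'a) pre_digraph \<Rightarrow> ('v \<Rightarrow> 'v) \<Rightarrow> ('v \<Rightarrow> nat) \<Rightarrow> complex \<Rightarrow> 'v form \<Rightarrow> bool" where
  "quadratic_space Q \<sigma>0 d \<epsilon> B \<longleftrightarrow>
     bilinear_form Q d B \<and>
     (\<forall>v\<in>graded_space Q d. (\<forall>w\<in>graded_space Q d. B v w = 0) \<longrightarrow> v = graded_zero Q d) \<and>
     (\<forall>v\<in>graded_space Q d. \<forall>w\<in>graded_space Q d. B v w = \<epsilon> * B w v) \<and>
     (\<forall>i\<in>verts Q. \<forall>j\<in>verts Q. j \<noteq> \<sigma>0 i \<longrightarrow>
        (\<forall>v\<in>graded_component Q d i. \<forall>w\<in>graded_component Q d j. B v w = 0))"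

text \<open>The endomorphism of \<open>V\<close> given by the sum of the maps of \<open>M\<close>.\<close>

definition rep_apply ::
  "('v, 'a) pre_digraph \<Rightarrow> ('v \<Rightarrow> nat) \<Rightarrow> ('a \<Rightarrow> complex mat) \<Rightarrow> ('v \<Rightarrow> complex vec)
    \<Rightarrow> 'v \<Rightarrow> complex vec" where
  "rep_apply Q d M v = (\<lambda>i\<in>verts Q. vec (d i)
     (\<lambda>k. \<Sum>a\<in>{a \<in> arcs Q. head Q a = i}. (M a *\<^sub>v v (tail Q a)) $ k))"

definition graded_apply ::
  "('v, 'a) pre_digraph \<Rightarrow> ('v \<Rightarrow> complex mat) \<Rightarrow> ('v \<Rightarrow> complex vec) \<Rightarrow> 'v \<Rightarrow> complex vec" where
  "graded_apply Q g v = (\<lambda>i\<in>verts Q. g i *\<^sub>v v i)"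

definition symmetric_rep_variety ::
  "('v, 'a) pre_digraph \<Rightarrow> (('v, 'a) path \<Rightarrow> complex) set \<Rightarrow> ('v \<Rightarrow> nat) \<Rightarrow> 'v form
    \<Rightarrow> ('a \<Rightarrow> complex mat) set" where
  "symmetric_rep_variety Q I d B = {M \<in> rep_variety Q I d.
     \<forall>v\<in>graded_space Q d. \<forall>w\<in>graded_space Q d.
       B (rep_apply Q d M v) w + B v (rep_apply Q d M w) = 0}"

definition G_bullet ::
  "('v, 'a) pre_digraph \<Rightarrow> ('v \<Rightarrow> nat) \<Rightarrow> 'v form \<Rightarrow> ('v \<Rightarrow> complex mat) set" where
  "G_bullet Q d B = {g \<in> GL_bullet Q d.
     \<forall>v\<in>graded_space Q d. \<forall>w\<in>graded_space Q d.
       B (graded_apply Q g v) (graded_apply Q g w) = B v w}"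


section \<open>Zariski closure and degenerations\<close>

text \<open>
  Closures are taken in the affine space of all tuples of linear maps. As \<open>R(A,V)\<close> is closed there,
  the closure of a subset of \<open>R(A,V)\<close> is the same as its closure in \<open>R(A,V)\<close>.
\<close>

inductive_set poly_functions ::
  "('v, 'a) pre_digraph \<Rightarrow> ('v \<Rightarrow> nat) \<Rightarrow> (('a \<Rightarrow> complex mat) \<Rightarrow> complex) set"
  for Q :: "('v, 'a) pre_digraph" and d :: "'v \<Rightarrow> nat" where
  const: "(\<lambda>M. c) \<in> poly_functions Q d"
| coord: "a \<in> arcs Q \<Longrightarrow> i < d (head Q a) \<Longrightarrow> j < d (tail Q a)
            \<Longrightarrow> (\<lambda>M. M a $$ (i, j)) \<in> poly_functions Q d"
| add: "f \<in> poly_functions Q d \<Longrightarrow> g \<in> poly_functions Q d \<Longrightarrow> (\<lambda>M. f M + g M) \<in> poly_functions Q d"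
| mult: "f \<in> poly_functions Q d \<Longrightarrow> g \<in> poly_functions Q d \<Longrightarrow> (\<lambda>M. f M * g M) \<in> poly_functions Q d"

definition zariski_closed ::
  "('v, 'a) pre_digraph \<Rightarrow> ('v \<Rightarrow> nat) \<Rightarrow> ('a \<Rightarrow> complex mat) set \<Rightarrow> bool" where
  "zariski_closed Q d Z \<longleftrightarrow>
     (\<exists>F\<subseteq>poly_functions Q d. Z = {M \<in> rep_tuples Q d. \<forall>f\<in>F. f M = 0})"

definition deg_le ::
  "('v, 'a) pre_digraph \<Rightarrow> ('v \<Rightarrow> nat) \<Rightarrow> ('a \<Rightarrow> complex mat) \<Rightarrow> ('a \<Rightarrow> complex mat) \<Rightarrow> bool" where
  "deg_le Q d M N \<longleftrightarrow> N \<in> zariski_closed Q d hull ((\<lambda>g. act Q d g M) ` GL_bullet Q d)"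

definition sym_deg_le ::
  "('v, 'a) pre_digraph \<Rightarrow> ('v \<Rightarrow> nat) \<Rightarrow> 'v form \<Rightarrow> ('a \<Rightarrow> complex mat) \<Rightarrow> ('a \<Rightarrow> complex mat) \<Rightarrow> bool" where
  "sym_deg_le Q d B M N \<longleftrightarrow> N \<in> zariski_closed Q d hull ((\<lambda>g. act Q d g M) ` G_bullet Q d B)"

end

theory Submission
  imports Defs "Jordan_Normal_Form.Determinant" "HOL-Computational_Algebra.Polynomial"
begin

text \<open>
  The quiver is a star \<open>1 \<rightarrow> 0 \<leftarrow> 2\<close>, \<open>3 \<leftarrow> 0 \<rightarrow> 4\<close> whose relations are that the paths \<open>1 \<rightarrow> 0 \<rightarrow> 3\<close> and
  \<open>2 \<rightarrow> 0 \<rightarrow> 4\<close> vanish; the involution exchanges \<open>1\<close> with \<open>3\<close> and \<open>2\<close> with \<open>4\<close>. A symmetric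
  representation of dimension \<open>2\<close> at the centre and \<open>1\<close> elsewhere with nonzero maps is a pair of isotropic
  lines in a hyperbolic plane. Such a plane has exactly two isotropic lines, so two distinct ones cannot
  be moved together by isometries, although linear maps can do so.

  The algebra has finite representation type because a representation is essentially a pair of flags
  \<open>im A \<subseteq> ker C\<close> and \<open>im B \<subseteq> ker D\<close> in the central space, and two flags always split compatibly
  into lines; hence indecomposables have dimension at most one at every vertex.
\<close>

section \<open>Linear algebra\<close>

text \<open>Symmetry makes the map into a sink the negative adjoint of the map out of the matching
  source, so each zero relation says exactly that the image of that source in the centre is
  isotropic. The relations thus serve twice: they give the rigidity of isotropic lines, and they
  keep the algebra of finite type, since the star with four outer vertices and no relations is of
  affine type D4 and has infinitely many indecomposables. For finite type no list of indecomposables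
  is made: it suffices to split from any nonzero representation a nonzero summand of dimension at
  most one at every vertex. At the centre this summand is given by a vector \<open>x\<close> and a
  functional \<open>y\<close> with \<open>y * x = 1\<close>, and both flags constrain the pair. The
  difficulty is to satisfy them together. It disappears because the first nonzero member of one flag
  constrains only \<open>x\<close>, so that \<open>y\<close> remains free for the other
  flag.\<close>

lemma fredholm_alternative_fun:
  fixes B :: "nat \<Rightarrow> nat \<Rightarrow> 'a::field"
  shows "(\<exists>x. \<forall>i<n. (\<Sum>j<m. B i j * x j) = b i) \<or>
    (\<exists>y. (\<forall>j<m. (\<Sum>i<n. y i * B i j) = 0) \<and> (\<Sum>i<n. y i * b i) = 1)"
proof (induction m arbitrary: b)
  case 0
  show ?case
  proof (cases "\<forall>i<n. b i = 0")
    case False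
    then obtain k where k: "k < n" "b k \<noteq> 0" by auto
    have "(\<Sum>i<n. (if i = k then 1 / b k else 0) * b i) = 1"
      using k by (simp add: if_distrib[of "\<lambda>z. z * _"] sum.delta cong: if_cong)
    then show ?thesis by (intro disjI2) auto
  qed simp
next
  case (Suc m)
  let ?c = "\<lambda>i. B i m"
  show ?case
  proof (cases "\<exists>x. \<forall>i<n. (\<Sum>j<m. B i j * x j) = b i")
    case True
    then obtain x where "\<forall>i<n. (\<Sum>j<m. B i j * x j) = b i" by auto
    then have "\<forall>i<n. (\<Sum>j<Suc m. B i j * (x(m := 0)) j) = b i" by simp
    then show ?thesis by blast
  next
    case False
    then obtain y where y: "\<forall>j<m. (\<Sum>i<n. y i * B i j) = 0" "(\<Sum>i<n. y i * b i) = 1"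
      using Suc.IH[of b] by auto
    let ?s = "\<Sum>i<n. y i * ?c i"
    show ?thesis
    proof (cases "?s = 0")
      case True
      then have "\<forall>j<Suc m. (\<Sum>i<n. y i * B i j) = 0" using y by (simp add: less_Suc_eq)
      then show ?thesis using y(2) by blast
    next
      case s: False
      \<comment> \<open>A multiple of the last column is subtracted from \<open>b\<close> so that
        \<open>y\<close> annihilates the result; it is given back as the last coefficient
        \<open>1 / ?s\<close>.\<close>
      define b' where "b' = (\<lambda>i. b i - ?c i / ?s)"
      show ?thesis using Suc.IH[of b']
      proof
        assume "\<exists>x. \<forall>i<n. (\<Sum>j<m. B i j * x j) = b' i"
        then obtain x where "\<forall>i<n. (\<Sum>j<m. B i j * x j) = b' i" by auto
        then have "\<forall>i<n. (\<Sum>j<Suc m. B i j * (x(m := 1 / ?s)) j) = b i" by (simp add: b'_def)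
        then show ?thesis by blast
      next
        assume "\<exists>y. (\<forall>j<m. (\<Sum>i<n. y i * B i j) = 0) \<and> (\<Sum>i<n. y i * b' i) = 1"
        then obtain z where z: "\<forall>j<m. (\<Sum>i<n. z i * B i j) = 0" "(\<Sum>i<n. z i * b' i) = 1" by auto
        let ?t = "\<Sum>i<n. z i * ?c i"
        \<comment> \<open>Subtracting a multiple of \<open>y\<close> makes \<open>z\<close> vanish
          on the last column. As \<open>y\<close> has value 1 on \<open>b\<close>, the value of
          \<open>w\<close> on \<open>b\<close> is that of \<open>z\<close> on \<open>b'\<close>,
          namely 1.\<close>
        define w where "w = (\<lambda>i. z i - ?t / ?s * y i)"
        have w: "(\<Sum>i<n. w i * h i) = (\<Sum>i<n. z i * h i) - ?t / ?s * (\<Sum>i<n. y i * h i)" for h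
          by (simp add: w_def left_diff_distrib sum_subtractf sum_distrib_left mult.assoc)
        have "(\<Sum>i<n. z i * b i) - ?t / ?s = 1"
          using z(2) by (simp add: b'_def right_diff_distrib sum_subtractf sum_divide_distrib)
        then have "(\<Sum>i<n. w i * b i) = 1" using y(2) by (simp add: w)
        moreover have "\<forall>j<Suc m. (\<Sum>i<n. w i * B i j) = 0"
          using y(1) z(1) s by (auto simp: w less_Suc_eq)
        ultimately show ?thesis by blast
      qed
    qed
  qed
qed

text \<open>Replaces bases and dimension counts in the treatment of flags: a vector outside the
  column space is separated from it by a functional with value exactly 1. Vectors and functionals
  are kept as one-column and one-row matrices, so that \<open>x * y\<close> is itself a matrix, a
  projection once \<open>y * x = 1\<close>.\<close>

lemma fredholm_alternative:
  fixes B :: "'a::field mat"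
  assumes B: "B \<in> carrier_mat n m" and b: "b \<in> carrier_mat n 1"
  shows "(\<exists>x\<in>carrier_mat m 1. b = B * x) \<or>
    (\<exists>y\<in>carrier_mat 1 n. y * B = 0\<^sub>m 1 m \<and> y * b = 1\<^sub>m 1)"
  using fredholm_alternative_fun[where n = n and m = m and B = "\<lambda>i j. B $$ (i, j)" and b = "\<lambda>i. b $$ (i, 0)"]
proof (elim disjE exE conjE)
  fix x assume "\<forall>i<n. (\<Sum>j<m. B $$ (i, j) * x j) = b $$ (i, 0)"
  then have "b = B * mat m 1 (\<lambda>(i, j). x i)"
    using B b by (intro eq_matI) (auto simp: scalar_prod_def lessThan_atLeast0)
  then show ?thesis by auto
next
  fix y assume y: "\<forall>j<m. (\<Sum>i<n. y i * B $$ (i, j)) = 0" "(\<Sum>i<n. y i * b $$ (i, 0)) = 1"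
  let ?y = "mat 1 n (\<lambda>(j, i). y i)"
  have "?y * B = 0\<^sub>m 1 m" "?y * b = 1\<^sub>m 1"
    using B b y by (auto intro!: eq_matI simp: scalar_prod_def lessThan_atLeast0)
  then show ?thesis by (intro disjI2 bexI[of _ ?y]) auto
qed

lemma Units_mat_ring:
  "g \<in> Units (mat_ring n) \<longleftrightarrow>
    g \<in> carrier_mat n n \<and> (\<exists>h\<in>carrier_mat n n. g * h = 1\<^sub>m n \<and> h * g = 1\<^sub>m n)"
  by (auto simp: Units_def ring_mat_simps)

lemma mat_ring_inv:
  assumes "g \<in> Units (mat_ring n)"
  shows "inv\<^bsub>mat_ring n\<^esub> g \<in> carrier_mat n n" "g * inv\<^bsub>mat_ring n\<^esub> g = 1\<^sub>m n"
    "inv\<^bsub>mat_ring n\<^esub> g * g = 1\<^sub>m n" "inv\<^bsub>mat_ring n\<^esub> g \<in> Units (mat_ring n)"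
proof -
  interpret ring "mat_ring n" by (rule ring_mat)
  show "inv\<^bsub>mat_ring n\<^esub> g \<in> carrier_mat n n" "g * inv\<^bsub>mat_ring n\<^esub> g = 1\<^sub>m n"
    "inv\<^bsub>mat_ring n\<^esub> g * g = 1\<^sub>m n" "inv\<^bsub>mat_ring n\<^esub> g \<in> Units (mat_ring n)"
    using assms Units_inv_closed[of g] Units_r_inv[of g] Units_l_inv[of g] by (simp_all add: ring_mat_simps)
qed

section \<open>Orbits and isomorphism\<close>

lemma rep_tuples_carrier:
  "M \<in> rep_tuples Q d \<Longrightarrow> a \<in> arcs Q \<Longrightarrow> M a \<in> carrier_mat (d (head Q a)) (d (tail Q a))"
  by (auto simp: rep_tuples_def)

lemma GL_bullet_Units: "g \<in> GL_bullet Q d \<Longrightarrow> i \<in> verts Q \<Longrightarrow> g i \<in> Units (mat_ring (d i))"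
  by (auto simp: GL_bullet_def)

lemma GL_bullet_carrier: "g \<in> GL_bullet Q d \<Longrightarrow> i \<in> verts Q \<Longrightarrow> g i \<in> carrier_mat (d i) (d i)"
  by (auto simp: GL_bullet_def Units_mat_ring)

context wf_digraph
begin

text \<open>Multiplying by the invertible matrix at the tail clears the inverse from the action, so
  that orbits and isomorphisms can be handled as intertwining relations.\<close>

lemma act_eq_iff:
  assumes g: "g \<in> GL_bullet G d" and M: "M \<in> rep_tuples G d" and N: "N \<in> rep_tuples G d"
  shows "act G d g M = N \<longleftrightarrow> (\<forall>a\<in>arcs G. g (head G a) * M a = N a * g (tail G a))"
proof -
  have *: "g (head G a) * M a * inv\<^bsub>mat_ring (d (tail G a))\<^esub> (g (tail G a)) = N a \<longleftrightarrow>
      g (head G a) * M a = N a * g (tail G a)" if a: "a \<in> arcs G" for a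
  proof -
    let ?n = "d (tail G a)"
    let ?g = "g (tail G a)"
    let ?h = "inv\<^bsub>mat_ring ?n\<^esub> ?g"
    have u: "?g \<in> Units (mat_ring ?n)" using GL_bullet_Units[OF g] a by simp
    note h = mat_ring_inv[OF u]
    have gc: "?g \<in> carrier_mat ?n ?n" using u by (simp add: Units_mat_ring)
    have Nc: "N a \<in> carrier_mat (d (head G a)) ?n" by (rule rep_tuples_carrier[OF N a])
    have L: "g (head G a) * M a \<in> carrier_mat (d (head G a)) ?n"
      using GL_bullet_carrier[OF g, of "head G a"] rep_tuples_carrier[OF M a] a by auto
    show ?thesis
    proof
      assume "g (head G a) * M a * ?h = N a"
      then have "N a * ?g = g (head G a) * M a * (?h * ?g)"
        using assoc_mult_mat[OF L h(1) gc] by simp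
      then show "g (head G a) * M a = N a * ?g" unfolding h(3) right_mult_one_mat[OF L] by (rule sym)
    next
      assume "g (head G a) * M a = N a * ?g"
      then have "g (head G a) * M a * ?h = N a * (?g * ?h)"
        using assoc_mult_mat[OF Nc gc h(1)] by simp
      then show "g (head G a) * M a * ?h = N a" unfolding h(2) right_mult_one_mat[OF Nc] .
    qed
  qed
  have "act G d g M = N \<longleftrightarrow> (\<forall>a\<in>arcs G. act G d g M a = N a)"
    using N by (auto simp: act_def rep_tuples_def fun_eq_iff PiE_iff extensional_def)
  then show ?thesis using * by (simp add: act_def)
qed

lemma rep_iso_iff:
  assumes "M \<in> rep_tuples G d" "N \<in> rep_tuples G d'"
  shows "((d, M), (d', N)) \<in> rep_iso G \<longleftrightarrow> (\<forall>i\<in>verts G. d i = d' i) \<and>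
    (\<exists>g\<in>GL_bullet G d. \<forall>a\<in>arcs G. g (head G a) * M a = N a * g (tail G a))"
proof (cases "\<forall>i\<in>verts G. d i = d' i")
  case True
  then have "N \<in> rep_tuples G d" using assms(2) by (auto simp: rep_tuples_def PiE_iff)
  then have "N = act G d g M \<longleftrightarrow> (\<forall>a\<in>arcs G. g (head G a) * M a = N a * g (tail G a))"
    if "g \<in> GL_bullet G d" for g
    using act_eq_iff[OF that assms(1)] by metis
  then show ?thesis using True by (auto simp: rep_iso_def)
qed (auto simp: rep_iso_def)

lemma rep_iso_sym:
  assumes M: "M \<in> rep_tuples G d" and N: "N \<in> rep_tuples G d'" and "((d, M), (d', N)) \<in> rep_iso G"
  shows "((d', N), (d, M)) \<in> rep_iso G"
proof -
  obtain g where d: "\<forall>i\<in>verts G. d i = d' i" and g: "g \<in> GL_bullet G d"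
    and gM: "\<forall>a\<in>arcs G. g (head G a) * M a = N a * g (tail G a)"
    using assms by (auto simp: rep_iso_iff)
  define h where "h = (\<lambda>i\<in>verts G. inv\<^bsub>mat_ring (d i)\<^esub> (g i))"
  have h: "h i \<in> carrier_mat (d i) (d i)" "g i * h i = 1\<^sub>m (d i)" "h i * g i = 1\<^sub>m (d i)"
    "h i \<in> Units (mat_ring (d i))" if "i \<in> verts G" for i
    using mat_ring_inv[OF GL_bullet_Units[OF g that]] that by (auto simp: h_def)
  have "h \<in> GL_bullet G d'" using h(4) d by (auto simp: GL_bullet_def h_def)
  moreover have "h (head G a) * N a = M a * h (tail G a)" if a: "a \<in> arcs G" for a
  proof -
    let ?m = "d (head G a)" and ?n = "d (tail G a)"
    have c: "M a \<in> carrier_mat ?m ?n" "N a \<in> carrier_mat ?m ?n" "h (head G a) \<in> carrier_mat ?m ?m"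
      "h (tail G a) \<in> carrier_mat ?n ?n" "g (head G a) \<in> carrier_mat ?m ?m"
      "g (tail G a) \<in> carrier_mat ?n ?n"
      using rep_tuples_carrier[OF M a] rep_tuples_carrier[OF N a] h d a GL_bullet_carrier[OF g] by auto
    have "h (head G a) * N a = h (head G a) * (N a * g (tail G a)) * h (tail G a)"
    proof -
      have "h (head G a) * (N a * g (tail G a)) * h (tail G a) =
          h (head G a) * (N a * (g (tail G a) * h (tail G a)))"
        using c assoc_mult_mat[of "h (head G a)" ?m ?m "N a * g (tail G a)" ?n "h (tail G a)" ?n]
          assoc_mult_mat[of "N a" ?m ?n "g (tail G a)" ?n "h (tail G a)" ?n] by simp
      then show ?thesis using h(2)[of "tail G a"] a c by simp
    qed
    also have "\<dots> = h (head G a) * (g (head G a) * M a) * h (tail G a)" using gM a by simp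
    also have "\<dots> = (h (head G a) * g (head G a)) * M a * h (tail G a)" using c by simp
    finally show ?thesis using h(3) a c by simp
  qed
  ultimately show ?thesis using d M N by (auto simp: rep_iso_iff)
qed

lemma rep_iso_trans:
  assumes M: "M \<in> rep_tuples G d" and N: "N \<in> rep_tuples G d'" and L: "L \<in> rep_tuples G d''"
    and "((d, M), (d', N)) \<in> rep_iso G" "((d', N), (d'', L)) \<in> rep_iso G"
  shows "((d, M), (d'', L)) \<in> rep_iso G"
proof -
  obtain g h where d: "\<forall>i\<in>verts G. d i = d' i" "\<forall>i\<in>verts G. d' i = d'' i"
    and g: "g \<in> GL_bullet G d" and h: "h \<in> GL_bullet G d'"
    and gM: "\<forall>a\<in>arcs G. g (head G a) * M a = N a * g (tail G a)"
    and hN: "\<forall>a\<in>arcs G. h (head G a) * N a = L a * h (tail G a)"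
    using assms by (auto simp: rep_iso_iff)
  define k where "k = (\<lambda>i\<in>verts G. h i * g i)"
  have "k i \<in> Units (mat_ring (d i))" if i: "i \<in> verts G" for i
  proof -
    interpret ring "mat_ring (d i)" by (rule ring_mat)
    have "h i \<in> Units (mat_ring (d i))" "g i \<in> Units (mat_ring (d i))"
      using GL_bullet_Units[OF g i] GL_bullet_Units[OF h i] d i by auto
    then have "h i \<otimes>\<^bsub>mat_ring (d i)\<^esub> g i \<in> Units (mat_ring (d i))" by (rule Units_m_closed)
    then show ?thesis using i by (simp add: k_def ring_mat_simps)
  qed
  then have "k \<in> GL_bullet G d" by (auto simp: GL_bullet_def k_def)
  moreover have "k (head G a) * M a = L a * k (tail G a)" if a: "a \<in> arcs G" for a
  proof -
    let ?m = "d (head G a)" and ?n = "d (tail G a)"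
    have c: "M a \<in> carrier_mat ?m ?n" "N a \<in> carrier_mat ?m ?n" "L a \<in> carrier_mat ?m ?n"
      "h (head G a) \<in> carrier_mat ?m ?m" "h (tail G a) \<in> carrier_mat ?n ?n"
      "g (head G a) \<in> carrier_mat ?m ?m" "g (tail G a) \<in> carrier_mat ?n ?n"
      using rep_tuples_carrier[OF M a] rep_tuples_carrier[OF N a] rep_tuples_carrier[OF L a] d a
        GL_bullet_carrier[OF g] GL_bullet_carrier[OF h] by auto
    have "h (head G a) * g (head G a) * M a = h (head G a) * (N a * g (tail G a))"
      using gM a c by auto
    also have "\<dots> = (h (head G a) * N a) * g (tail G a)" using c by auto
    also have "\<dots> = L a * (h (tail G a) * g (tail G a))" using hN a c by auto
    finally show ?thesis using a by (simp add: k_def)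
  qed
  ultimately show ?thesis using d M L by (auto simp: rep_iso_iff)
qed

end

section \<open>Splitting off a direct summand\<close>

lemma add_left_cancel_mat:
  fixes A :: "'a::ab_group_add mat"
  assumes "A \<in> carrier_mat n m" "B \<in> carrier_mat n m" "C \<in> carrier_mat n m" "A + B = A + C"
  shows "B = C"
proof (rule eq_matI)
  fix i j assume "i < dim_row C" "j < dim_col C"
  then show "B $$ (i, j) = C $$ (i, j)"
    using assms(1-3) arg_cong[OF assms(4), of "\<lambda>A. A $$ (i, j)"] by simp
qed (use assms in auto)

text \<open>Exposes the idempotent \<open>e * f\<close> on the left of \<open>M\<close>; once it has
  been commuted with \<open>M\<close>, the primed variant releases it on the right, where it can be
  absorbed.\<close>

lemma mult_middle_assoc:
  fixes X :: "'a::comm_ring_1 mat"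
  assumes X: "X \<in> carrier_mat n1 n2" and P: "P \<in> carrier_mat n2 n3" and e: "e \<in> carrier_mat n3 n4"
    and f: "f \<in> carrier_mat n4 n3" and M: "M \<in> carrier_mat n3 n5" and E: "E \<in> carrier_mat n5 n6"
  shows "X * P * e * (f * M * E) = X * (P * (e * f * M) * E)"
proof -
  note XP = mult_carrier_mat[OF X P] and ef = mult_carrier_mat[OF e f]
  note efM = mult_carrier_mat[OF ef M] and fM = mult_carrier_mat[OF f M]
  have "X * P * e * (f * M * E) = X * P * (e * (f * M * E))"
    by (rule assoc_mult_mat[OF XP e mult_carrier_mat[OF fM E]])
  also have "\<dots> = X * P * (e * f * M * E)"
    by (simp only: assoc_mult_mat[OF e fM E, symmetric] assoc_mult_mat[OF e f M, symmetric])
  also have "\<dots> = X * (P * (e * f * M * E))"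
    by (rule assoc_mult_mat[OF X P mult_carrier_mat[OF efM E]])
  also have "\<dots> = X * (P * (e * f * M) * E)"
    by (simp only: assoc_mult_mat[OF P efM E, symmetric])
  finally show ?thesis .
qed

lemma mult_middle_assoc':
  fixes X :: "'a::comm_ring_1 mat"
  assumes X: "X \<in> carrier_mat n1 n2" and P: "P \<in> carrier_mat n2 n3" and M: "M \<in> carrier_mat n3 n4"
    and e: "e \<in> carrier_mat n4 n5" and f: "f \<in> carrier_mat n5 n4" and E: "E \<in> carrier_mat n4 n6"
  shows "X * (P * (M * (e * f)) * E) = X * (P * M) * (e * (f * E))"
proof -
  note PM = mult_carrier_mat[OF P M] and ef = mult_carrier_mat[OF e f]
  show ?thesis
    by (simp only: assoc_mult_mat[OF P M ef, symmetric] assoc_mult_mat[OF PM ef E] assoc_mult_mat[OF e f E]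
        assoc_mult_mat[OF X PM mult_carrier_mat[OF e mult_carrier_mat[OF f E]]])
qed

lemma append_rows_mult:
  assumes "A \<in> carrier_mat m1 n" "B \<in> carrier_mat m2 n" "C \<in> carrier_mat n k"
  shows "(A @\<^sub>r B) * C = (A * C) @\<^sub>r (B * (C :: 'a :: comm_ring_1 mat))"
proof -
  \<comment> \<open>Blocks of width or height zero, so that the block product formula applies to
    stacked rows.\<close>
  have C: "C = four_block_mat C (0\<^sub>m n 0) (0\<^sub>m 0 k) (0\<^sub>m 0 0)"
    using assms by (intro eq_matI) auto
  have "(A @\<^sub>r B) * C = four_block_mat A (0\<^sub>m m1 0) B (0\<^sub>m m2 0) *
      four_block_mat C (0\<^sub>m n 0) (0\<^sub>m 0 k) (0\<^sub>m 0 0)"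
    using C assms by (simp add: append_rows_def)
  also have "\<dots> = four_block_mat (A * C) (0\<^sub>m m1 0) (B * C) (0\<^sub>m m2 0)"
    using assms by (subst mult_four_block_mat[of _ m1 n _ 0 _ m2 _ _ k _ 0]) auto
  finally show ?thesis using assms by (simp add: append_rows_def)
qed

lemma four_block_diag_mult_append_rows:
  assumes "A \<in> carrier_mat m1 n1" "D \<in> carrier_mat m2 n2" "B \<in> carrier_mat n1 k" "C \<in> carrier_mat n2 k"
  shows "four_block_mat A (0\<^sub>m m1 n2) (0\<^sub>m m2 n1) D * (B @\<^sub>r C) = (A * B) @\<^sub>r (D * (C :: 'a :: comm_ring_1 mat))"
proof -
  have "four_block_mat A (0\<^sub>m m1 n2) (0\<^sub>m m2 n1) D * (B @\<^sub>r C) =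
     four_block_mat A (0\<^sub>m m1 n2) (0\<^sub>m m2 n1) D * four_block_mat B (0\<^sub>m n1 0) C (0\<^sub>m n2 0)"
    using assms by (simp add: append_rows_def)
  also have "\<dots> = four_block_mat (A * B) (0\<^sub>m m1 0) (D * C) (0\<^sub>m m2 0)"
    using assms by (subst mult_four_block_mat[of _ m1 n1 _ n2 _ m2 _ _ k _ 0]) auto
  finally show ?thesis using assms by (simp add: append_rows_def)
qed

text \<open>\<open>e'\<close> is an inclusion of the kernel of \<open>f\<close>, and
  \<open>f'\<close> a projection along the line of \<open>e\<close>; explicit formulas take the
  place of a choice of basis.\<close>

lemma split_idempotent_rank1:
  fixes e f :: "'a::field mat"
  assumes e: "e \<in> carrier_mat n 1" and f: "f \<in> carrier_mat 1 n" and fe: "f * e = 1\<^sub>m 1"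
  obtains e' f' where "e' \<in> carrier_mat n (n - 1)" "f' \<in> carrier_mat (n - 1) n"
    "f' * e' = 1\<^sub>m (n - 1)" "f * e' = 0\<^sub>m 1 (n - 1)" "f' * e = 0\<^sub>m (n - 1) 1" "0 < n"
proof -
  have fe1: "(\<Sum>k<n. f $$ (0, k) * e $$ (k, 0)) = 1"
    using arg_cong[OF fe, of "\<lambda>A. A $$ (0, 0)"] e f by (simp add: scalar_prod_def lessThan_atLeast0)
  have "\<not> (\<forall>j<n. e $$ (j, 0) = 0)"
  proof
    assume "\<forall>j<n. e $$ (j, 0) = 0"
    then have "(\<Sum>k<n. f $$ (0, k) * e $$ (k, 0)) = 0" by (intro sum.neutral) simp
    then show False using fe1 by simp
  qed
  then obtain j where j: "j < n" "e $$ (j, 0) \<noteq> 0" by blast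
  \<comment> \<open>\<open>s\<close> enumerates the indices below \<open>n\<close> other than
    \<open>j\<close>: the successor runs through the positive ones, and 0 fills the gap left by
    \<open>j\<close>.\<close>
  define s where "s = (\<lambda>i. if Suc i = j then 0 else Suc i)"
  have s: "s i < n" "s i \<noteq> j" "s i = s i' \<longleftrightarrow> i = i'" if "i < n - 1" "i' < n - 1" for i i'
    using that j by (auto simp: s_def)
  \<comment> \<open>Row \<open>i\<close> of \<open>f'\<close> reads coordinate \<open>s i\<close>
    after subtraction of the multiple of \<open>e\<close> that clears coordinate \<open>j\<close>.
    Column \<open>i\<close> of \<open>e'\<close> is the unit vector at \<open>s i\<close> pushed
    along \<open>e\<close> into the kernel of \<open>f\<close>. As \<open>f'\<close> does not see
    multiples of \<open>e\<close>, the product \<open>f' * e'\<close> is the identity.\<close>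
  define f' where "f' = mat (n - 1) n (\<lambda>(i, k). (if k = s i then 1 else 0) -
    (if k = j then e $$ (s i, 0) / e $$ (j, 0) else 0))"
  define e' where "e' = mat n (n - 1) (\<lambda>(k, i). (if k = s i then 1 else 0) - f $$ (0, s i) * e $$ (k, 0))"
  have f'x: "(\<Sum>k<n. f' $$ (i, k) * x k) = x (s i) - e $$ (s i, 0) / e $$ (j, 0) * x j"
    if i: "i < n - 1" for i x
  proof -
    have "(\<Sum>k<n. f' $$ (i, k) * x k) = (\<Sum>k<n. (if k = s i then x k else 0)) -
        (\<Sum>k<n. if k = j then e $$ (s i, 0) / e $$ (j, 0) * x k else 0)"
      unfolding sum_subtractf[symmetric] using i by (intro sum.cong refl) (auto simp: f'_def left_diff_distrib)
    then show ?thesis using s[OF i i] j by simp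
  qed
  have dim: "dim_row f' = n - 1" "dim_col f' = n" by (simp_all add: f'_def)
  have "f' * e = 0\<^sub>m (n - 1) 1"
  proof (intro eq_matI)
    fix a i assume "a < dim_row (0\<^sub>m (n - 1) 1 :: 'a mat)" "i < dim_col (0\<^sub>m (n - 1) 1 :: 'a mat)"
    then have a: "a < n - 1" and i: "i = 0" by auto
    have "(f' * e) $$ (a, i) = (\<Sum>k<n. f' $$ (a, k) * e $$ (k, 0))"
      using a i e dim by (simp add: scalar_prod_def lessThan_atLeast0)
    then show "(f' * e) $$ (a, i) = 0\<^sub>m (n - 1) 1 $$ (a, i)" using f'x[OF a] a i j(2) by simp
  qed (use e dim in auto)
  moreover have "f * e' = 0\<^sub>m 1 (n - 1)"
  proof (intro eq_matI)
    fix a i assume "a < dim_row (0\<^sub>m 1 (n - 1) :: 'a mat)" "i < dim_col (0\<^sub>m 1 (n - 1) :: 'a mat)"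
    then have a: "a = 0" and i: "i < n - 1" by auto
    have "(f * e') $$ (a, i) = (\<Sum>k<n. f $$ (0, k) * e' $$ (k, i))"
      using a i f by (simp add: scalar_prod_def lessThan_atLeast0 e'_def)
    also have "\<dots> = (\<Sum>k<n. if k = s i then f $$ (0, k) else 0) -
        (\<Sum>k<n. f $$ (0, s i) * (f $$ (0, k) * e $$ (k, 0)))"
      unfolding sum_subtractf[symmetric] using i
      by (intro sum.cong refl) (auto simp: e'_def right_diff_distrib)
    also have "\<dots> = 0" using s[OF i i] fe1 by (simp add: sum_distrib_left[symmetric])
    finally show "(f * e') $$ (a, i) = 0\<^sub>m 1 (n - 1) $$ (a, i)" using a i by simp
  qed (use f in \<open>auto simp: e'_def\<close>)
  moreover have "f' * e' = 1\<^sub>m (n - 1)"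
  proof (intro eq_matI)
    fix a i assume "a < dim_row (1\<^sub>m (n - 1) :: 'a mat)" "i < dim_col (1\<^sub>m (n - 1) :: 'a mat)"
    then have a: "a < n - 1" and i: "i < n - 1" by auto
    have "(f' * e') $$ (a, i) = (\<Sum>k<n. f' $$ (a, k) * e' $$ (k, i))"
      using a i by (simp add: scalar_prod_def lessThan_atLeast0 e'_def f'_def)
    also have "\<dots> = e' $$ (s a, i) - e $$ (s a, 0) / e $$ (j, 0) * e' $$ (j, i)" by (rule f'x[OF a])
    also have "\<dots> = (if a = i then 1 else 0)"
      using s[OF a i] s[OF i i] a i j by (simp add: e'_def)
    finally show "(f' * e') $$ (a, i) = 1\<^sub>m (n - 1) $$ (a, i)" using a i by simp
  qed (auto simp: e'_def f'_def)
  ultimately show thesis using j by (intro that[of e' f']) (auto simp: e'_def f'_def)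
qed

lemma split_idempotent:
  fixes e f :: "'a::field mat"
  assumes e: "e \<in> carrier_mat n r" and f: "f \<in> carrier_mat r n" and fe: "f * e = 1\<^sub>m r" and r: "r \<le> 1"
  obtains e' f' where "e' \<in> carrier_mat n (n - r)" "f' \<in> carrier_mat (n - r) n"
    "f' * e' = 1\<^sub>m (n - r)" "e * f + e' * f' = 1\<^sub>m n" "f @\<^sub>r f' \<in> carrier_mat n n"
    "\<exists>h\<in>carrier_mat n n. (f @\<^sub>r f') * h = 1\<^sub>m n \<and> h * (f @\<^sub>r f') = 1\<^sub>m n" "r \<le> n"
proof -
  obtain e' f' where *: "e' \<in> carrier_mat n (n - r)" "f' \<in> carrier_mat (n - r) n"
    "f' * e' = 1\<^sub>m (n - r)" "f * e' = 0\<^sub>m r (n - r)" "f' * e = 0\<^sub>m (n - r) r" and rn: "r \<le> n"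
  proof (cases "r = 0")
    case True
    show thesis using e f by (intro that[of "1\<^sub>m n" "1\<^sub>m n"]) (auto simp: True)
  next
    case False
    then have "r = 1" using r by simp
    obtain e' f' where "e' \<in> carrier_mat n (n - 1)" "f' \<in> carrier_mat (n - 1) n"
      "f' * e' = 1\<^sub>m (n - 1)" "f * e' = 0\<^sub>m 1 (n - 1)" "f' * e = 0\<^sub>m (n - 1) 1" "0 < n"
      by (rule split_idempotent_rank1[OF e[unfolded \<open>r = 1\<close>] f[unfolded \<open>r = 1\<close>] fe[unfolded \<open>r = 1\<close>]])
    then show thesis by (intro that[of e' f']) (simp_all add: \<open>r = 1\<close>)
  qed
  let ?h = "four_block_mat e e' (0\<^sub>m 0 r) (0\<^sub>m 0 (n - r))"
  have g: "f @\<^sub>r f' \<in> carrier_mat n n" using carrier_append_rows[OF f *(2)] rn by simp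
  have h: "?h \<in> carrier_mat n n" using four_block_carrier_mat[of e n r "0\<^sub>m 0 (n - r)" 0 "n - r"] e rn by auto
  have "(f @\<^sub>r f') * ?h = four_block_mat f (0\<^sub>m r 0) f' (0\<^sub>m (n - r) 0) * ?h"
    using f * by (simp add: append_rows_def)
  also have "\<dots> = four_block_mat (1\<^sub>m r) (0\<^sub>m r (n - r)) (0\<^sub>m (n - r) r) (1\<^sub>m (n - r))"
    using e f * fe by (subst mult_four_block_mat[of _ r n _ 0 _ "n - r" _ _ r _ "n - r"]) auto
  also have "\<dots> = 1\<^sub>m n" using rn by simp
  finally have gh: "(f @\<^sub>r f') * ?h = 1\<^sub>m n" .
  \<comment> \<open>For square matrices a one-sided inverse is two-sided; in this order the product
    is the decomposition \<open>e * f + e' * f' = 1\<close>.\<close>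
  then have hg: "?h * (f @\<^sub>r f') = 1\<^sub>m n" by (rule mat_mult_left_right_inverse[OF g h])
  have "?h * (f @\<^sub>r f') = ?h * four_block_mat f (0\<^sub>m r 0) f' (0\<^sub>m (n - r) 0)"
    using f * by (simp add: append_rows_def)
  also have "\<dots> = four_block_mat (e * f + e' * f') (0\<^sub>m n 0) (0\<^sub>m 0 n) (0\<^sub>m 0 0)"
    using e f * by (subst mult_four_block_mat[of _ n r _ "n - r" _ 0 _ _ n _ 0]) auto
  also have "\<dots> = e * f + e' * f'"
    using e f * by (intro eq_matI) auto
  finally have "e * f + e' * f' = 1\<^sub>m n" using hg by simp
  then show thesis using that * g h gh hg rn by blast
qed

text \<open>\<open>e\<close> is the inclusion and \<open>f\<close> the projection of a direct summand with dimension vector \<open>r\<close>.\<close>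

definition rep_retract ::
  "('v, 'a) pre_digraph \<Rightarrow> ('v \<Rightarrow> nat) \<Rightarrow> ('a \<Rightarrow> complex mat) \<Rightarrow> ('v \<Rightarrow> nat) \<Rightarrow>
    ('v \<Rightarrow> complex mat) \<Rightarrow> ('v \<Rightarrow> complex mat) \<Rightarrow> bool" where
  "rep_retract Q d M r e f \<longleftrightarrow>
    (\<forall>i\<in>verts Q. e i \<in> carrier_mat (d i) (r i) \<and> f i \<in> carrier_mat (r i) (d i) \<and> f i * e i = 1\<^sub>m (r i)) \<and>
    (\<forall>a\<in>arcs Q. M a * (e (tail Q a) * f (tail Q a)) = (e (head Q a) * f (head Q a)) * M a)"

section \<open>Compressing a representation to a retract\<close>

context wf_digraph
begin

text \<open>An idempotent that commutes with every arrow commutes with every path, so the copies of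
  \<open>e * f\<close> inserted between consecutive arrows can all be moved to the start, where
  \<open>e u\<close> absorbs them.\<close>

lemma path_mat_retract:
  assumes M: "M \<in> rep_tuples G d" and ef: "rep_retract G d M r e f" and p: "awalk u p v"
  shows "path_mat G d M u p \<in> carrier_mat (d v) (d u) \<and>
    path_mat G d M u p * (e u * f u) = (e v * f v) * path_mat G d M u p \<and>
    path_mat G r (\<lambda>a\<in>arcs G. f (head G a) * M a * e (tail G a)) u p = f v * path_mat G d M u p * e u"
  using p
proof (induction p arbitrary: u)
  case Nil
  then show ?case using ef by (auto simp: rep_retract_def awalk_Nil_iff)
next
  case (Cons a p)
  let ?N = "\<lambda>a\<in>arcs G. f (head G a) * M a * e (tail G a)"
  let ?h = "head G a" and ?P = "path_mat G d M (head G a) p"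
  have a: "a \<in> arcs G" "tail G a = u" "awalk ?h p v" using Cons.prems by (auto simp: awalk_Cons_iff)
  have verts: "u \<in> verts G" "?h \<in> verts G" "v \<in> verts G" using a by auto
  have c: "e i \<in> carrier_mat (d i) (r i)" "f i \<in> carrier_mat (r i) (d i)" "e i * f i \<in> carrier_mat (d i) (d i)"
    "f i * e i = 1\<^sub>m (r i)" if "i \<in> verts G" for i
    using ef that by (auto simp: rep_retract_def)
  note cu = c[OF verts(1)] and ch = c[OF verts(2)] and cv = c[OF verts(3)]
  have Ma: "M a \<in> carrier_mat (d ?h) (d u)" using rep_tuples_carrier[OF M a(1)] a by simp
  have com: "M a * (e u * f u) = (e ?h * f ?h) * M a" using ef a by (auto simp: rep_retract_def)
  have IH: "?P \<in> carrier_mat (d v) (d ?h)" "?P * (e ?h * f ?h) = (e v * f v) * ?P"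
    "path_mat G r ?N ?h p = f v * ?P * e ?h" using Cons.IH[OF a(3)] by blast+
  have "?P * M a * (e u * f u) = ?P * ((e ?h * f ?h) * M a)" using IH Ma cu com by (simp add: assoc_mult_mat[OF IH(1) Ma cu(3)])
  also have "\<dots> = (e v * f v) * ?P * M a" using IH(2) assoc_mult_mat[OF IH(1) ch(3) Ma] by simp
  also have "\<dots> = (e v * f v) * (?P * M a)" using assoc_mult_mat[OF cv(3) IH(1) Ma] by simp
  finally have com': "?P * M a * (e u * f u) = (e v * f v) * (?P * M a)" .
  have PM: "?P * M a \<in> carrier_mat (d v) (d u)" using IH Ma by auto
  have "f v * ?P * e ?h * (f ?h * M a * e u) = f v * (?P * ((e ?h * f ?h) * M a) * e u)"
    by (rule mult_middle_assoc[OF cv(2) IH(1) ch(1,2) Ma cu(1)])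
  also have "\<dots> = f v * (?P * (M a * (e u * f u)) * e u)" by (simp only: com)
  also have "\<dots> = f v * (?P * M a) * (e u * (f u * e u))"
    by (rule mult_middle_assoc'[OF cv(2) IH(1) Ma cu(1,2,1)])
  also have "\<dots> = f v * (?P * M a) * e u" using cu by simp
  finally have "f v * ?P * e ?h * (f ?h * M a * e u) = f v * (?P * M a) * e u" .
  moreover have "?N a = f ?h * M a * e u" using a by simp
  ultimately show ?case using com' PM by (simp add: IH(3) del: restrict_apply)
qed

lemma triple_mult_index:
  assumes "F \<in> carrier_mat r m" "P \<in> carrier_mat m n" "E \<in> carrier_mat n s" "i < r" "j < s"
  shows "(F * P * E) $$ (i, j) = (\<Sum>k<m. \<Sum>l<n. F $$ (i, k) * P $$ (k, l) * (E $$ (l, j) :: 'z :: comm_ring_1))"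
  using assms by (auto simp: scalar_prod_def lessThan_atLeast0 sum_distrib_left mult.assoc)

text \<open>The entries of a compressed path matrix are combinations of the original entries with
  coefficients that depend only on the end points, so a vanishing combination of paths stays
  vanishing.\<close>

lemma rep_variety_retract:
  assumes M: "M \<in> rep_variety G I d" and ef: "rep_retract G d M r e f"
  shows "(\<lambda>a\<in>arcs G. f (head G a) * M a * e (tail G a)) \<in> rep_variety G I r"
    (is "?N \<in> _")
proof -
  have Mt: "M \<in> rep_tuples G d" and Mr: "\<And>\<rho>. \<rho> \<in> I \<Longrightarrow> satisfies_relation G d M \<rho>"
    using M by (auto simp: rep_variety_def)
  have c: "e i \<in> carrier_mat (d i) (r i)" "f i \<in> carrier_mat (r i) (d i)" if "i \<in> verts G" for i
    using ef that by (auto simp: rep_retract_def)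
  have "?N \<in> rep_tuples G r" using mult_carrier_mat[OF mult_carrier_mat[OF c(2) rep_tuples_carrier[OF Mt]] c(1)]
    by (auto simp: rep_tuples_def)
  moreover have "satisfies_relation G r ?N \<rho>" if "\<rho> \<in> I" for \<rho>
    unfolding satisfies_relation_def
  proof (intro ballI allI impI)
    fix u v i j assume u: "u \<in> verts G" and v: "v \<in> verts G" and i: "i < r v" and j: "j < r u"
    let ?P = "{p. \<rho> (u, p) \<noteq> 0 \<and> awalk u p v}"
    let ?M = "path_mat G d M u"
    have "(\<Sum>p\<in>?P. \<rho> (u, p) * path_mat G r ?N u p $$ (i, j)) =
      (\<Sum>p\<in>?P. \<Sum>k<d v. \<Sum>l<d u. f v $$ (i, k) * e u $$ (l, j) * (\<rho> (u, p) * ?M p $$ (k, l)))"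
    proof (intro sum.cong refl)
      fix p assume "p \<in> ?P"
      then have p: "awalk u p v" by simp
      have P: "?M p \<in> carrier_mat (d v) (d u)" "path_mat G r ?N u p = f v * ?M p * e u"
        using path_mat_retract[OF Mt ef p] by auto
      have "path_mat G r ?N u p $$ (i, j) = (\<Sum>k<d v. \<Sum>l<d u. f v $$ (i, k) * ?M p $$ (k, l) * e u $$ (l, j))"
        unfolding P(2) by (rule triple_mult_index[OF c(2)[OF v] P(1) c(1)[OF u] i j])
      then show "\<rho> (u, p) * path_mat G r ?N u p $$ (i, j) =
          (\<Sum>k<d v. \<Sum>l<d u. f v $$ (i, k) * e u $$ (l, j) * (\<rho> (u, p) * ?M p $$ (k, l)))"
        by (simp add: sum_distrib_left mult_ac)
    qed
    also have "\<dots> = (\<Sum>k<d v. \<Sum>l<d u. f v $$ (i, k) * e u $$ (l, j) * (\<Sum>p\<in>?P. \<rho> (u, p) * ?M p $$ (k, l)))"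
      unfolding sum_distrib_left by (subst sum.swap, intro sum.cong refl, rule sum.swap)
    also have "\<dots> = 0"
      using Mr[OF that] u v unfolding satisfies_relation_def by (intro sum.neutral ballI) auto
    finally show "(\<Sum>p\<in>?P. \<rho> (u, p) * path_mat G r ?N u p $$ (i, j)) = 0" .
  qed
  ultimately show ?thesis by (auto simp: rep_variety_def)
qed

text \<open>The complementary idempotent \<open>1 - e * f\<close> also commutes with the arrows and
  cuts out a second representation; stacking \<open>f\<close> on its projection \<open>f'\<close>
  identifies \<open>M\<close> with the direct sum of the two. Indecomposability then forces the
  complement to be zero.\<close>

lemma indecomposable_retract:
  assumes X: "(d, M) \<in> indecomposables G I" and ef: "rep_retract G d M r e f"
    and r1: "\<And>i. i \<in> verts G \<Longrightarrow> r i \<le> 1" and r0: "\<exists>i\<in>verts G. r i \<noteq> 0"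
  shows "\<forall>i\<in>verts G. d i = r i"
proof -
  have M: "M \<in> rep_variety G I d" and Mt: "M \<in> rep_tuples G d"
    using X by (auto simp: indecomposables_def reps_def rep_variety_def)
  have c: "e i \<in> carrier_mat (d i) (r i)" "f i \<in> carrier_mat (r i) (d i)" "f i * e i = 1\<^sub>m (r i)"
    if "i \<in> verts G" for i using ef that by (auto simp: rep_retract_def)
  have com: "M a * (e (tail G a) * f (tail G a)) = (e (head G a) * f (head G a)) * M a"
    if "a \<in> arcs G" for a using ef that by (auto simp: rep_retract_def)
  define q where "q i = d i - r i" for i
  let ?S = "\<lambda>i p. fst p \<in> carrier_mat (d i) (q i) \<and> snd p \<in> carrier_mat (q i) (d i) \<and>
    snd p * fst p = 1\<^sub>m (q i) \<and> e i * f i + fst p * snd p = 1\<^sub>m (d i) \<and>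
    f i @\<^sub>r snd p \<in> Units (mat_ring (d i)) \<and> r i \<le> d i"
  have "\<exists>p. ?S i p" if i: "i \<in> verts G" for i
    unfolding q_def Units_mat_ring split_paired_Ex fst_conv snd_conv
    by (rule split_idempotent[OF c[OF i] r1[OF i]]) blast
  then obtain p where p: "\<forall>i\<in>verts G. ?S i (p i)" using bchoice[of "verts G" ?S] by blast
  define e' f' where "e' = (\<lambda>i. fst (p i))" and "f' = (\<lambda>i. snd (p i))"
  have *: "e' i \<in> carrier_mat (d i) (q i)" "f' i \<in> carrier_mat (q i) (d i)" "f' i * e' i = 1\<^sub>m (q i)"
    "e i * f i + e' i * f' i = 1\<^sub>m (d i)" "f i @\<^sub>r f' i \<in> Units (mat_ring (d i))" "r i \<le> d i"
    if "i \<in> verts G" for i using p that by (auto simp: e'_def f'_def)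
  have com': "M a * (e' (tail G a) * f' (tail G a)) = (e' (head G a) * f' (head G a)) * M a"
    if a: "a \<in> arcs G" for a
  proof -
    have v: "tail G a \<in> verts G" "head G a \<in> verts G" using a by auto
    note t = c[OF v(1)] *[OF v(1)] and h = c[OF v(2)] *[OF v(2)]
    have Ma: "M a \<in> carrier_mat (d (head G a)) (d (tail G a))" by (rule rep_tuples_carrier[OF Mt a])
    let ?p = "e (tail G a) * f (tail G a)" and ?p' = "e' (tail G a) * f' (tail G a)"
    let ?q = "e (head G a) * f (head G a)" and ?q' = "e' (head G a) * f' (head G a)"
    have pc: "?p \<in> carrier_mat (d (tail G a)) (d (tail G a))" "?p' \<in> carrier_mat (d (tail G a)) (d (tail G a))"
      "?q \<in> carrier_mat (d (head G a)) (d (head G a))" "?q' \<in> carrier_mat (d (head G a)) (d (head G a))"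
      using t h by auto
    have "M a * ?p + M a * ?p' = M a * (?p + ?p')" using mult_add_distrib_mat[OF Ma pc(1,2)] by simp
    also have "\<dots> = (?q + ?q') * M a" using t(7) h(7) Ma by simp
    also have "\<dots> = ?q * M a + ?q' * M a" using add_mult_distrib_mat[OF pc(3,4) Ma] by simp
    finally have eq: "M a * ?p + M a * ?p' = M a * ?p + ?q' * M a" using com[OF a] by simp
    then show ?thesis
      using add_left_cancel_mat[of "M a * ?p" "d (head G a)" "d (tail G a)" "M a * ?p'" "?q' * M a"] pc Ma
      by (meson mult_carrier_mat)
  qed
  have ef': "rep_retract G d M q e' f'" using * com' by (auto simp: rep_retract_def)
  let ?N = "\<lambda>a\<in>arcs G. f (head G a) * M a * e (tail G a)"
  let ?N' = "\<lambda>a\<in>arcs G. f' (head G a) * M a * e' (tail G a)"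
  have N: "?N \<in> rep_variety G I r" "?N' \<in> rep_variety G I q"
    using rep_variety_retract[OF M] ef ef' by auto
  define g where "g = (\<lambda>i\<in>verts G. f i @\<^sub>r f' i)"
  have "((d, M), rep_sum G (r, ?N) (q, ?N')) \<in> rep_iso G"
  proof -
    let ?L = "\<lambda>a\<in>arcs G. four_block_mat (?N a) (0\<^sub>m (r (head G a)) (q (tail G a)))
      (0\<^sub>m (q (head G a)) (r (tail G a))) (?N' a)"
    have L: "?L \<in> rep_tuples G (\<lambda>i. r i + q i)"
      using N by (auto intro!: four_block_carrier_mat simp: rep_variety_def rep_tuples_def)
    have "g \<in> GL_bullet G d" using * by (auto simp: GL_bullet_def g_def)
    moreover have "g (head G a) * M a = ?L a * g (tail G a)" if a: "a \<in> arcs G" for a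
    proof -
      have v: "tail G a \<in> verts G" "head G a \<in> verts G" using a by auto
      note t = c[OF v(1)] *[OF v(1)] and h = c[OF v(2)] *[OF v(2)]
      have Ma: "M a \<in> carrier_mat (d (head G a)) (d (tail G a))" by (rule rep_tuples_carrier[OF Mt a])
      \<comment> \<open>Compressing and then projecting is the same as projecting: the idempotent
        moves across \<open>M a\<close> and is absorbed by \<open>F * E' = 1\<close>.\<close>
      have key: "F * M a * E * F2 = F * M a" if "F \<in> carrier_mat k (d (head G a))" "E' \<in> carrier_mat (d (head G a)) k"
         "F * E' = 1\<^sub>m k" "E \<in> carrier_mat (d (tail G a)) l" "F2 \<in> carrier_mat l (d (tail G a))"
         "M a * (E * F2) = (E' * F) * M a" for F E' E F2 k l
      proof -
        have "F * M a * E * F2 = F * (M a * (E * F2))"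
          using assoc_mult_mat[OF mult_carrier_mat[OF that(1) Ma] that(4,5)]
            assoc_mult_mat[OF that(1) Ma mult_carrier_mat[OF that(4,5)]] by simp
        also have "\<dots> = F * E' * (F * M a)"
          unfolding that(6) assoc_mult_mat[OF that(2,1) Ma]
          by (rule assoc_mult_mat[OF that(1,2) mult_carrier_mat[OF that(1) Ma], symmetric])
        also have "\<dots> = F * M a" using that(1,3) Ma by simp
        finally show ?thesis .
      qed
      have "g (head G a) * M a = (f (head G a) * M a) @\<^sub>r (f' (head G a) * M a)"
        using v append_rows_mult[OF h(2) h(5) Ma] by (simp add: g_def)
      also have "\<dots> = (?N a * f (tail G a)) @\<^sub>r (?N' a * f' (tail G a))"
        using key[OF h(2,1,3) t(1,2) com[OF a]] key[OF h(5,4,6) t(4,5) com'[OF a]] a by simp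
      also have "\<dots> = ?L a * g (tail G a)"
        using four_block_diag_mult_append_rows[of "?N a" "r (head G a)" "r (tail G a)" "?N' a"
            "q (head G a)" "q (tail G a)", OF _ _ t(2,5)] a v N
        by (simp add: g_def rep_variety_def rep_tuples_def PiE_iff)
      finally show ?thesis .
    qed
    moreover have "\<forall>i\<in>verts G. d i = r i + q i" using *(6) by (simp add: q_def)
    ultimately have "((d, M), (\<lambda>i. r i + q i, ?L)) \<in> rep_iso G"
      unfolding rep_iso_iff[OF Mt L] by blast
    then show ?thesis by (simp add: rep_sum_def cong: restrict_cong)
  qed
  moreover have "\<not> zero_rep G (r, ?N)" using r0 by (auto simp: zero_rep_def)
  ultimately have "zero_rep G (q, ?N')"
    using X N unfolding indecomposables_def reps_def by blast
  then show ?thesis using *(6) by (fastforce simp: zero_rep_def q_def)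
qed

end

section \<open>Ideals of path algebras\<close>

lemma mult_path_algebra: "f \<otimes>\<^bsub>path_algebra Q\<^esub> g = path_mult Q f g"
  by (simp add: path_algebra_def)

lemma path_mult_nonzero:
  assumes "path_mult Q f g (u, p) \<noteq> 0"
  obtains q r where "p = q @ r" "f (pre_digraph.awlast Q u q, r) \<noteq> 0" "g (u, q) \<noteq> 0"
proof -
  obtain k where "f (pre_digraph.awlast Q u (take k p), drop k p) * g (u, take k p) \<noteq> 0"
    using assms unfolding path_mult_def prod.case by (meson sum.neutral)
  then show thesis by (intro that[of "take k p" "drop k p"]) auto
qed

lemma path_mult_single:
  assumes "pre_digraph.awlast Q u p = v"
  shows "path_mult Q (\<lambda>x. if x = (v, q) then c else 0) (\<lambda>x. if x = (u, p) then c' else 0) =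
    (\<lambda>x. if x = (u, p @ q) then c * c' else 0)"
proof (rule ext, clarify)
  fix w s
  have split: "w = u \<and> take k s = p \<and> drop k s = q \<longleftrightarrow> k = length p \<and> w = u \<and> s = p @ q"
    if "k \<le> length s" for k
    using that by (metis append_eq_conv_conj append_take_drop_id length_take min.absorb2)
  have "path_mult Q (\<lambda>x. if x = (v, q) then c else 0) (\<lambda>x. if x = (u, p) then c' else 0) (w, s) =
      (\<Sum>k\<le>length s. if k = length p then (if w = u \<and> s = p @ q then c * c' else 0) else 0)"
    unfolding path_mult_def prod.case
  proof (intro sum.cong refl)
    fix k assume "k \<in> {..length s}"
    then have k: "k \<le> length s" by simp
    have "(if (pre_digraph.awlast Q w (take k s), drop k s) = (v, q) then c else 0) *
        (if (w, take k s) = (u, p) then c' else 0) =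
        (if w = u \<and> take k s = p \<and> drop k s = q then c * c' else 0)"
      using assms by (cases "w = u \<and> take k s = p") auto
    also have "\<dots> = (if k = length p then if w = u \<and> s = p @ q then c * c' else 0 else 0)"
      unfolding split[OF k] by (cases "k = length p") simp_all
    finally show "(if (pre_digraph.awlast Q w (take k s), drop k s) = (v, q) then c else 0) *
        (if (w, take k s) = (u, p) then c' else 0) =
        (if k = length p then if w = u \<and> s = p @ q then c * c' else 0 else 0)" .
  qed
  also have "\<dots> = (if (w, s) = (u, p @ q) then c * c' else 0)" by (auto simp: sum.delta)
  finally show "path_mult Q (\<lambda>x. if x = (v, q) then c else 0) (\<lambda>x. if x = (u, p) then c' else 0) (w, s) =
      (if (w, s) = (u, p @ q) then c * c' else 0)" .
qed

lemma ideal_path_algebraI: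
  assumes Q: "fin_digraph Q"
    and sub: "I \<subseteq> carrier (path_algebra Q)" and zero: "(\<lambda>_. 0) \<in> I"
    and add: "\<And>f g. f \<in> I \<Longrightarrow> g \<in> I \<Longrightarrow> (\<lambda>x. f x + g x) \<in> I"
    and minus: "\<And>f. f \<in> I \<Longrightarrow> (\<lambda>x. - f x) \<in> I"
    and mult: "\<And>f g. f \<in> I \<Longrightarrow> g \<in> carrier (path_algebra Q) \<Longrightarrow> path_mult Q g f \<in> I"
      "\<And>f g. f \<in> I \<Longrightarrow> g \<in> carrier (path_algebra Q) \<Longrightarrow> path_mult Q f g \<in> I"
  shows "ideal I (path_algebra Q)"
proof -
  interpret R: ring "path_algebra Q" by (rule ring_path_algebra[OF Q])
  have neg: "\<ominus>\<^bsub>path_algebra Q\<^esub> f = (\<lambda>x. - f x)" if "f \<in> I" for f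
    using sub minus[OF that] that by (intro R.minus_equality) (auto simp: path_algebra_def)
  have "subgroup I (add_monoid (path_algebra Q))"
  proof (rule group.subgroupI)
    show "group (add_monoid (path_algebra Q))" by (rule R.a_group)
    show "inv\<^bsub>add_monoid (path_algebra Q)\<^esub> f \<in> I" if "f \<in> I" for f
      using neg[OF that] minus[OF that] by (simp add: a_inv_def)
  qed (use sub zero add in \<open>auto simp: path_algebra_def\<close>)
  then show ?thesis
    by (rule idealI[OF R.ring_axioms]) (use mult in \<open>auto simp: path_algebra_def\<close>)
qed

definition length_ideal :: "('v, 'a) pre_digraph \<Rightarrow> nat \<Rightarrow> (('v, 'a) path \<Rightarrow> complex) set" where
  "length_ideal Q k = {f \<in> carrier (path_algebra Q). \<forall>u p. f (u, p) \<noteq> 0 \<longrightarrow> k \<le> length p}"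

lemma ideal_length_ideal:
  assumes Q: "fin_digraph Q"
  shows "ideal (length_ideal Q k) (path_algebra Q)"
proof -
  interpret R: ring "path_algebra Q" by (rule ring_path_algebra[OF Q])
  show ?thesis
  proof (rule ideal_path_algebraI[OF Q])
    fix f g assume f: "f \<in> length_ideal Q k" and g: "g \<in> length_ideal Q k"
    have "(\<lambda>x. f x + g x) \<in> carrier (path_algebra Q)"
      using R.add.m_closed[of f g] f g by (simp add: length_ideal_def path_algebra_def)
    moreover have "k \<le> length p" if "f (u, p) + g (u, p) \<noteq> 0" for u p
    proof -
      have "f (u, p) \<noteq> 0 \<or> g (u, p) \<noteq> 0" using that by auto
      then show ?thesis using f g by (auto simp: length_ideal_def)
    qed
    ultimately show "(\<lambda>x. f x + g x) \<in> length_ideal Q k" by (simp add: length_ideal_def)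
  next
    fix f g assume f: "f \<in> length_ideal Q k" and g: "g \<in> carrier (path_algebra Q)"
    then have "path_mult Q g f \<in> carrier (path_algebra Q)" "path_mult Q f g \<in> carrier (path_algebra Q)"
      using R.m_closed[of f g] R.m_closed[of g f] by (auto simp: length_ideal_def path_algebra_def)
    moreover have "k \<le> length p" if nz: "path_mult Q g f (u, p) \<noteq> 0 \<or> path_mult Q f g (u, p) \<noteq> 0" for u p
    proof -
      obtain q r v where qr: "p = q @ r" "f (u, q) \<noteq> 0 \<or> f (v, r) \<noteq> 0"
        using nz by (elim disjE path_mult_nonzero) (use that in blast)+
      then have "k \<le> length q \<or> k \<le> length r" using f unfolding length_ideal_def by blast
      then show ?thesis using qr(1) by auto
    qed
    ultimately show "path_mult Q g f \<in> length_ideal Q k" "path_mult Q f g \<in> length_ideal Q k"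
      by (auto simp: length_ideal_def)
  qed (auto simp: length_ideal_def path_algebra_def)
qed

lemma arrow_elem_carrier:
  assumes "fin_digraph Q" "a \<in> arcs Q"
  shows "arrow_elem Q a \<in> carrier (path_algebra Q)"
proof -
  interpret fin_digraph Q by fact
  have "{x. arrow_elem Q a x \<noteq> 0} = {(tail Q a, [a])}" by (auto simp: arrow_elem_def)
  moreover have "(tail Q a, [a]) \<in> paths Q" using assms(2) by (auto simp: paths_def awalk_def)
  ultimately show ?thesis by (simp add: path_algebra_def)
qed

text \<open>Lengths add under concatenation. For a quiver without long paths this makes a power of
  the arrow ideal zero.\<close>

lemma arrow_ideal_pow_length:
  assumes Q: "fin_digraph Q"
  shows "arrow_ideal Q [^]\<^bsub>ideals_set (path_algebra Q)\<^esub> (n::nat) \<subseteq> length_ideal Q n"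
proof (induction n)
  case 0
  then show ?case by (auto simp: nat_pow_def ideals_set_def length_ideal_def)
next
  case (Suc n)
  interpret R: ring "path_algebra Q" by (rule ring_path_algebra[OF Q])
  have "arrow_elem Q ` arcs Q \<subseteq> length_ideal Q 1"
    using arrow_elem_carrier[OF Q] by (auto simp: length_ideal_def arrow_elem_def[of Q, THEN fun_cong] split: if_splits)
  then have A: "arrow_ideal Q \<subseteq> length_ideal Q 1"
    unfolding arrow_ideal_def by (intro R.genideal_minimal ideal_length_ideal[OF Q])
  interpret L: ideal "length_ideal Q (Suc n)" "path_algebra Q" by (rule ideal_length_ideal[OF Q])
  have "x \<in> length_ideal Q (Suc n)" if "x \<in> ideal_prod (path_algebra Q) (length_ideal Q n) (length_ideal Q 1)" for x
    using that
  proof induction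
    case (prod f g)
    then have "f \<in> carrier (path_algebra Q)" "g \<in> carrier (path_algebra Q)"
      unfolding length_ideal_def by blast+
    then have "f \<otimes>\<^bsub>path_algebra Q\<^esub> g \<in> carrier (path_algebra Q)" by (rule R.m_closed)
    moreover have "Suc n \<le> length p" if "(f \<otimes>\<^bsub>path_algebra Q\<^esub> g) (u, p) \<noteq> 0" for u p
    proof -
      have "path_mult Q f g (u, p) \<noteq> 0" using that by (simp add: path_algebra_def)
      then obtain q r where qr: "p = q @ r" "f (pre_digraph.awlast Q u q, r) \<noteq> 0" "g (u, q) \<noteq> 0"
        by (rule path_mult_nonzero)
      then have "n \<le> length r" "1 \<le> length q" using prod unfolding length_ideal_def by blast+
      then show ?thesis using qr(1) by simp
    qed
    ultimately show ?case unfolding length_ideal_def by blast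
  qed (rule L.a_closed)
  moreover have "ideal_prod (path_algebra Q) J K \<subseteq> ideal_prod (path_algebra Q) J' K'"
    if "J \<subseteq> J'" "K \<subseteq> K'" for J K J' K'
  proof
    fix x assume "x \<in> ideal_prod (path_algebra Q) J K"
    then show "x \<in> ideal_prod (path_algebra Q) J' K'"
      by induction (use that in \<open>auto intro: ideal_prod.intros\<close>)
  qed
  ultimately show ?case using Suc A by (simp add: nat_pow_def ideals_set_def) blast
qed


section \<open>The star quiver\<close>

text \<open>
  Vertices \<open>1\<close> and \<open>2\<close> are sources, \<open>3\<close> and \<open>4\<close> are sinks; each arrow has the name of its outer vertex,
  so that \<open>star_flip\<close> serves as the involution both of the vertices and of the arrows.
\<close>

definition star :: "(nat, nat) pre_digraph" where
  "star = \<lparr> verts = {0, 1, 2, 3, 4}, arcs = {1, 2, 3, 4},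
     tail = (\<lambda>a. if a \<le> 2 then a else 0), head = (\<lambda>a. if a \<le> 2 then 0 else a) \<rparr>"

definition star_flip :: "nat \<Rightarrow> nat" where
  "star_flip i = (if i = 1 then 3 else if i = 3 then 1 else if i = 2 then 4 else if i = 4 then 2 else i)"

text \<open>Given by supports, hence the linear span of the two zero relations. The span is already
  an ideal, because both paths run from a source to a sink and cannot be prolonged.\<close>

definition star_ideal :: "((nat, nat) path \<Rightarrow> complex) set" where
  "star_ideal = {f. \<forall>x. f x \<noteq> 0 \<longrightarrow> x = (1, [1, 3]) \<or> x = (2, [2, 4])}"

lemma star_simps [simp]:
  "verts star = {0, 1, 2, 3, 4}" "arcs star = {1, 2, 3, 4}"
  "tail star a = (if a \<le> 2 then a else 0)" "head star a = (if a \<le> 2 then 0 else a)"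
  by (simp_all add: star_def)

lemma fin_digraph_star: "fin_digraph star"
  by unfold_locales auto

interpretation star: fin_digraph star by (rule fin_digraph_star)

lemma star_awalk_sink: "u = 3 \<or> u = 4 \<Longrightarrow> star.awalk u p v \<longleftrightarrow> p = [] \<and> v = u"
  by (cases p) (auto simp: star.awalk_Nil_iff star.awalk_Cons_iff)

lemma star_awalk_centre:
  "star.awalk 0 p v \<longleftrightarrow> p = [] \<and> v = 0 \<or> p = [3] \<and> v = 3 \<or> p = [4] \<and> v = 4"
proof (cases p)
  case (Cons a q)
  have "star.awalk 0 p v \<longleftrightarrow> (a = 3 \<or> a = 4) \<and> star.awalk a q v"
    by (auto simp: Cons star.awalk_Cons_iff)
  then show ?thesis using star_awalk_sink[of a q v] by (auto simp: Cons)
qed (auto simp: star.awalk_Nil_iff)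

lemma star_awalk_source:
  assumes "u = 1 \<or> u = 2"
  shows "star.awalk u p v \<longleftrightarrow> p = [] \<and> v = u \<or> p = [u] \<and> v = 0 \<or> p = [u, 3] \<and> v = 3 \<or> p = [u, 4] \<and> v = 4"
proof (cases p)
  case (Cons a q)
  have "star.awalk u p v \<longleftrightarrow> a = u \<and> star.awalk 0 q v"
    using assms by (auto simp: Cons star.awalk_Cons_iff)
  then show ?thesis using star_awalk_centre[of q v] by (auto simp: Cons)
qed (use assms in \<open>auto simp: star.awalk_Nil_iff\<close>)

lemma star_paths:
  "paths star = {0, 1, 2, 3, 4} \<times> {[]} \<union>
     {(1, [1]), (2, [2]), (0, [3]), (0, [4]), (1, [1, 3]), (1, [1, 4]), (2, [2, 3]), (2, [2, 4])}"
    (is "_ = ?S")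
proof -
  have "(\<exists>v. star.awalk u p v) \<longleftrightarrow> (u, p) \<in> ?S" for u p
  proof -
    consider "u = 0" | "u = 1 \<or> u = 2" | "u = 3 \<or> u = 4" | "u \<notin> verts star" by auto
    then show ?thesis
    proof cases
      case 1
      then show ?thesis by (simp add: star_awalk_centre) blast
    next
      case 2
      show ?thesis unfolding star_awalk_source[OF 2] using 2 by auto
    next
      case 3
      show ?thesis unfolding star_awalk_sink[OF 3] using 3 by auto
    next
      case 4
      then show ?thesis using star.awalk_hd_in_verts by (auto dest: star.awalkE)
    qed
  qed
  then show ?thesis by (auto simp: paths_def)
qed

lemma star_ideal_carrier: "star_ideal \<subseteq> carrier (path_algebra star)"
proof
  fix f assume "f \<in> star_ideal"
  then have "{x. f x \<noteq> 0} \<subseteq> {(1, [1, 3]), (2, [2, 4])}" unfolding star_ideal_def by blast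
  moreover have "{(1, [1, 3]), (2, [2, 4])} \<subseteq> paths star" unfolding star_paths by blast
  ultimately have "finite {x. f x \<noteq> 0}" "{x. f x \<noteq> 0} \<subseteq> paths star"
    by (metis finite.emptyI finite_insert finite_subset, blast)
  then show "f \<in> carrier (path_algebra star)" by (simp add: path_algebra_def)
qed

lemma ideal_star_ideal: "ideal star_ideal (path_algebra star)"
proof (rule ideal_path_algebraI[OF fin_digraph_star star_ideal_carrier])
  fix f g assume f: "f \<in> star_ideal" and g: "g \<in> carrier (path_algebra star)"
  have f': "(u, p) = (1, [1, 3]) \<or> (u, p) = (2, [2, 4])" if "f (u, p) \<noteq> 0" for u p
    using f that unfolding star_ideal_def by blast
  have g': "(u, p) \<in> paths star" if "g (u, p) \<noteq> 0" for u p
    using g that unfolding path_algebra_def by auto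
  have "(u, p) = (1, [1, 3]) \<or> (u, p) = (2, [2, 4])" if nz: "path_mult star g f (u, p) \<noteq> 0" for u p
  proof -
    obtain q r where qr: "p = q @ r" "g (star.awlast u q, r) \<noteq> 0" "f (u, q) \<noteq> 0"
      by (rule path_mult_nonzero[OF nz])
    then show ?thesis using f'[OF qr(3)] g'[OF qr(2)] by (auto simp: star_paths)
  qed
  then show "path_mult star g f \<in> star_ideal" unfolding star_ideal_def split_paired_All by blast
  have "(u, p) = (1, [1, 3]) \<or> (u, p) = (2, [2, 4])" if nz: "path_mult star f g (u, p) \<noteq> 0" for u p
  proof -
    obtain q r where qr: "p = q @ r" "f (star.awlast u q, r) \<noteq> 0" "g (u, q) \<noteq> 0"
      by (rule path_mult_nonzero[OF nz])
    then show ?thesis using f'[OF qr(2)] g'[OF qr(3)] by (auto simp: star_paths awlast_if split: if_splits)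
  qed
  then show "path_mult star f g \<in> star_ideal" unfolding star_ideal_def split_paired_All by blast
next
  fix f g assume "f \<in> star_ideal" "g \<in> star_ideal"
  moreover have "f x \<noteq> 0 \<or> g x \<noteq> 0" if "f x + g x \<noteq> 0" for x using that by auto
  ultimately show "(\<lambda>x. f x + g x) \<in> star_ideal" unfolding star_ideal_def by blast
qed (auto simp: star_ideal_def)

text \<open>Reversing \<open>[1, 3]\<close> and flipping its arrows gives \<open>[1, 3]\<close>
  back, and likewise for \<open>[2, 4]\<close>: the involution fixes each relation.\<close>

lemma star_ideal_sigma: "algebra_sigma star star_flip star_flip ` star_ideal = star_ideal"
proof -
  have "algebra_sigma star star_flip star_flip f = f" if f: "f \<in> star_ideal" for f
  proof
    fix x
    have supp: "f x = 0" if "x \<noteq> (1, [1, 3])" "x \<noteq> (2, [2, 4])" for x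
      using f that unfolding star_ideal_def by blast
    show "algebra_sigma star star_flip star_flip f x = f x"
    proof (cases "x \<in> paths star")
      case True
      then show ?thesis unfolding star_paths
        by (auto simp: algebra_sigma_def path_sigma_def star_flip_def supp star_paths)
    next
      case False
      then show ?thesis using supp[of x] by (auto simp: algebra_sigma_def star_paths)
    qed
  qed
  then show ?thesis by simp
qed

lemma admissible_star_ideal: "admissible_ideal star star_ideal"
proof -
  let ?A = "path_algebra star"
  interpret R: ring ?A by (rule ring_path_algebra[OF fin_digraph_star])
  \<comment> \<open>No path of the star has three arrows, so this ideal is zero.\<close>
  have "length_ideal star 3 \<subseteq> star_ideal"
  proof
    fix f assume f: "f \<in> length_ideal star 3"
    have "f x = 0" for x
    proof (rule ccontr)
      assume nz: "f x \<noteq> 0"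
      then have "x \<in> paths star" using f by (auto simp: length_ideal_def path_algebra_def)
      moreover have "3 \<le> length (snd x)" using f nz by (cases x) (auto simp: length_ideal_def)
      ultimately show False by (auto simp: star_paths)
    qed
    then show "f \<in> star_ideal" by (simp add: star_ideal_def)
  qed
  then have 3: "arrow_ideal star [^]\<^bsub>ideals_set ?A\<^esub> (3::nat) \<subseteq> star_ideal"
    using arrow_ideal_pow_length[OF fin_digraph_star, of 3] by blast
  have arrows: "arrow_elem star ` arcs star \<subseteq> carrier ?A"
    using arrow_elem_carrier[OF fin_digraph_star] by auto
  interpret J: ideal "arrow_ideal star" ?A
    unfolding arrow_ideal_def by (rule R.genideal_ideal[OF arrows])
  have arr: "arrow_elem star a \<in> arrow_ideal star" if "a \<in> arcs star" for a
    using R.genideal_self[OF arrows] that by (auto simp: arrow_ideal_def)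
  have "f \<in> arrow_ideal star [^]\<^bsub>ideals_set ?A\<^esub> (2::nat)" if f: "f \<in> star_ideal" for f
  proof -
    have scal: "(\<lambda>x. if x = (u, []) then c else 0) \<in> carrier ?A" if "u \<in> verts star" for u c
    proof -
      have sub: "{x. (if x = (u, [] :: nat list) then c else 0) \<noteq> 0} \<subseteq> {(u, [])}" by auto
      moreover have "{(u, [])} \<subseteq> paths star" using that by (auto simp: star_paths)
      ultimately have "{x. (if x = (u, [] :: nat list) then c else 0) \<noteq> 0} \<subseteq> paths star" by (rule subset_trans)
      then show ?thesis using finite_subset[OF sub] by (simp add: path_algebra_def)
    qed
    \<comment> \<open>A path of length two is the arrow \<open>b\<close> after the arrow
      \<open>a\<close>. The scalar \<open>c\<close> enters through a multiple of the trivial path at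
      the end, since an ideal absorbs ring elements and a scalar has to be one.\<close>
    have *: "(\<lambda>x. if x = (tail star a, [a, b]) then c else 0) \<in> arrow_ideal star [^]\<^bsub>ideals_set ?A\<^esub> (2::nat)"
      if ab: "a \<in> arcs star" "b \<in> arcs star" "head star a = tail star b" for a b c
    proof -
      have "path_mult star (\<lambda>x. if x = (head star b, []) then c else 0) (arrow_elem star b) \<in> arrow_ideal star"
        using J.I_l_closed[OF arr[OF ab(2)] scal[of "head star b" c]] ab(2)
        by (simp only: star.head_in_verts mult_path_algebra)
      then have b: "(\<lambda>x. if x = (tail star b, [b]) then c else 0) \<in> arrow_ideal star"
        unfolding arrow_elem_def by (subst (asm) path_mult_single) (simp_all only: awlast_if mult_1_right append_Nil2, simp_all)
      \<comment> \<open>The second power unfolds to (carrier times arrow ideal) times arrow ideal,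
        so the inner product is given an explicit factor 1.\<close>
      have "\<one>\<^bsub>?A\<^esub> \<otimes>\<^bsub>?A\<^esub> (\<lambda>x. if x = (tail star b, [b]) then c else 0) \<in>
          ideal_prod ?A (carrier ?A) (arrow_ideal star)"
        using b by (intro ideal_prod.prod) auto
      then have "(\<lambda>x. if x = (tail star b, [b]) then c else 0) \<in>
          ideal_prod ?A (carrier ?A) (arrow_ideal star)"
        using J.Icarr[OF b] by simp
      from ideal_prod.prod[OF this arr[OF ab(1)], of ?A]
      have "path_mult star (\<lambda>x. if x = (tail star b, [b]) then c else 0) (arrow_elem star a) \<in>
          ideal_prod ?A (ideal_prod ?A (carrier ?A) (arrow_ideal star)) (arrow_ideal star)"
        by (simp only: mult_path_algebra)
      then have "(\<lambda>x. if x = (tail star a, [a] @ [b]) then c else 0) \<in>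
          ideal_prod ?A (ideal_prod ?A (carrier ?A) (arrow_ideal star)) (arrow_ideal star)"
        unfolding arrow_elem_def using ab(3) by (subst (asm) path_mult_single) (simp_all only: awlast_if mult_1_right, simp_all)
      then show ?thesis by (simp add: nat_pow_def ideals_set_def numeral_2_eq_2)
    qed
    have sum: "g \<oplus>\<^bsub>?A\<^esub> h \<in> arrow_ideal star [^]\<^bsub>ideals_set ?A\<^esub> (2::nat)"
      if "g \<in> arrow_ideal star [^]\<^bsub>ideals_set ?A\<^esub> (2::nat)" "h \<in> arrow_ideal star [^]\<^bsub>ideals_set ?A\<^esub> (2::nat)" for g h
      using that ideal_prod.sum by (simp add: nat_pow_def ideals_set_def numeral_2_eq_2)
    have f_eq: "f = (\<lambda>x. if x = (1, [1, 3]) then f (1, [1, 3]) else 0) \<oplus>\<^bsub>?A\<^esub>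
        (\<lambda>x. if x = (2, [2, 4]) then f (2, [2, 4]) else 0)"
      using f by (auto simp: path_algebra_def star_ideal_def fun_eq_iff)
    have "(\<lambda>x. if x = (1, [1, 3]) then c else 0) \<in> arrow_ideal star [^]\<^bsub>ideals_set ?A\<^esub> (2::nat)"
      "(\<lambda>x. if x = (2, [2, 4]) then c else 0) \<in> arrow_ideal star [^]\<^bsub>ideals_set ?A\<^esub> (2::nat)" for c
      using *[of 1 3 c] *[of 2 4 c] by simp_all
    from sum[OF this(1)[of "f (1, [1, 3])"] this(2)[of "f (2, [2, 4])"]] show ?thesis
      unfolding f_eq[symmetric] .
  qed
  then show ?thesis using ideal_star_ideal 3 by (auto simp: admissible_ideal_def)
qed

lemma symmetric_quiver_algebra_star: "symmetric_quiver_algebra star star_ideal star_flip star_flip"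
  using fin_digraph_star admissible_star_ideal star_ideal_sigma
  by (auto simp: symmetric_quiver_algebra_def symmetric_quiver_def star_flip_def)

section \<open>Finite representation type\<close>

lemma satisfies_relationD:
  assumes "satisfies_relation Q d M \<rho>" "u \<in> verts Q" "v \<in> verts Q" "i < d v" "j < d u"
  shows "(\<Sum>p\<in>{p. \<rho> (u, p) \<noteq> 0 \<and> pre_digraph.awalk Q u p v}.
    \<rho> (u, p) * path_mat Q d M u p $$ (i, j)) = 0"
  using assms unfolding satisfies_relation_def by blast

text \<open>For fixed end points an element of the ideal has at most one path in its support, so
  each relation concerns a single matrix product and nothing can cancel.\<close>

lemma star_rep_variety_iff:
  "M \<in> rep_variety star star_ideal d \<longleftrightarrow>
    M \<in> rep_tuples star d \<and> M 3 * M 1 = 0\<^sub>m (d 3) (d 1) \<and> M 4 * M 2 = 0\<^sub>m (d 4) (d 2)"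
proof (cases "M \<in> rep_tuples star d")
  case M: True
  have c: "M 1 \<in> carrier_mat (d 0) (d 1)" "M 2 \<in> carrier_mat (d 0) (d 2)"
    "M 3 \<in> carrier_mat (d 3) (d 0)" "M 4 \<in> carrier_mat (d 4) (d 0)"
    using rep_tuples_carrier[OF M, of 1] rep_tuples_carrier[OF M, of 2]
      rep_tuples_carrier[OF M, of 3] rep_tuples_carrier[OF M, of 4] by auto
  have pm: "path_mat star d M u [u, b] = M b * M u" if "u = 1 \<and> b = 3 \<or> u = 2 \<and> b = 4" for u b
    using that c by auto
  have prod: "(\<forall>\<rho>\<in>star_ideal. satisfies_relation star d M \<rho>) \<longleftrightarrow>
    (\<forall>i<d 3. \<forall>j<d 1. (M 3 * M 1) $$ (i, j) = 0) \<and> (\<forall>i<d 4. \<forall>j<d 2. (M 4 * M 2) $$ (i, j) = 0)"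
    (is "?l \<longleftrightarrow> ?r")
  proof
    assume ?l
    have "(M b * M u) $$ (i, j) = 0" if ub: "u = 1 \<and> b = 3 \<or> u = 2 \<and> b = 4" "i < d b" "j < d u" for u b i j
    proof -
      let ?\<rho> = "\<lambda>x. if x = (u, [u, b]) then 1 else 0 :: complex"
      have "?\<rho> \<in> star_ideal" using ub(1) by (auto simp: star_ideal_def)
      then have "satisfies_relation star d M ?\<rho>" using \<open>?l\<close> by blast
      then have "(\<Sum>p\<in>{p. ?\<rho> (u, p) \<noteq> 0 \<and> star.awalk u p b}. ?\<rho> (u, p) * path_mat star d M u p $$ (i, j)) = 0"
        by (rule satisfies_relationD) (use ub in auto)
      moreover have "{p. ?\<rho> (u, p) \<noteq> 0 \<and> star.awalk u p b} = {[u, b]}"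
        using ub(1) star_awalk_source[of u "[u, b]" b] by auto
      ultimately show ?thesis using pm[OF ub(1)] by simp
    qed
    from this[of 1 3] this[of 2 4] show ?r by blast
  next
    assume r: ?r
    show ?l unfolding satisfies_relation_def
    proof (intro ballI allI impI sum.neutral)
      fix \<rho> u v i j p assume \<rho>: "\<rho> \<in> star_ideal" and ij: "i < d v" "j < d u"
        and p: "p \<in> {p. \<rho> (u, p) \<noteq> 0 \<and> star.awalk u p v}"
      have "(u, p) = (1, [1, 3]) \<or> (u, p) = (2, [2, 4])" using \<rho> p unfolding star_ideal_def by blast
      then have "path_mat star d M u p $$ (i, j) = 0"
        using p r ij pm[of 1 3] pm[of 2 4] star_awalk_source[of u p v]
        by (auto simp del: path_mat.simps index_mult_mat)
      then show "\<rho> (u, p) * path_mat star d M u p $$ (i, j) = 0" by simp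
    qed
  qed
  have "(\<forall>i<n. \<forall>j<m. (A * B) $$ (i, j) = 0) \<longleftrightarrow> A * B = 0\<^sub>m n m"
    if "A \<in> carrier_mat n k" "B \<in> carrier_mat k m" for A B :: "complex mat" and n m k
    using that by (auto simp del: index_mult_mat(1) intro!: eq_matI)
  from this[OF c(3,1)] this[OF c(4,2)] show ?thesis using M prod by (simp add: rep_variety_def)
qed (auto simp: rep_variety_def)

text \<open>
  For a sequence of maps \<open>A\<close>, \<open>C\<close> with \<open>C A = 0\<close>, a vector \<open>x\<close> of the middle space and a functional \<open>y\<close>
  on it, the projection \<open>x y\<close> extends to a projection of the whole sequence.
\<close>

definition projection_extends :: "complex mat \<Rightarrow> complex mat \<Rightarrow> complex mat \<Rightarrow> complex mat \<Rightarrow> bool" where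
  "projection_extends A C x y \<longleftrightarrow>
    (\<exists>r1 e1 f1. r1 \<le> 1 \<and> e1 \<in> carrier_mat (dim_col A) r1 \<and> f1 \<in> carrier_mat r1 (dim_col A) \<and>
      f1 * e1 = 1\<^sub>m r1 \<and> A * (e1 * f1) = (x * y) * A) \<and>
    (\<exists>r3 e3 f3. r3 \<le> 1 \<and> e3 \<in> carrier_mat (dim_row C) r3 \<and> f3 \<in> carrier_mat r3 (dim_row C) \<and>
      f3 * e3 = 1\<^sub>m r3 \<and> C * (x * y) = (e3 * f3) * C)"

section \<open>Extending a central projection along a zero sequence\<close>

context
  fixes A C x y :: "complex mat" and n m k :: nat
  assumes A: "A \<in> carrier_mat n m" and C: "C \<in> carrier_mat k n" and CA: "C * A = 0\<^sub>m k m"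
    and x: "x \<in> carrier_mat n 1" and y: "y \<in> carrier_mat 1 n" and yx: "y * x = 1\<^sub>m 1"
begin

lemma extend_source_zero:
  assumes "y * A = 0\<^sub>m 1 m"
  shows "\<exists>r1 e1 f1. r1 \<le> 1 \<and> e1 \<in> carrier_mat (dim_col A) r1 \<and> f1 \<in> carrier_mat r1 (dim_col A) \<and>
      f1 * e1 = 1\<^sub>m r1 \<and> A * (e1 * f1) = (x * y) * A"
proof (intro exI conjI)
  show "A * (0\<^sub>m m 0 * 0\<^sub>m 0 m) = (x * y) * A"
    using assms A x y assoc_mult_mat[OF x y A] by simp
qed (use A in auto)

lemma extend_sink_zero:
  assumes "C * x = 0\<^sub>m k 1"
  shows "\<exists>r3 e3 f3. r3 \<le> 1 \<and> e3 \<in> carrier_mat (dim_row C) r3 \<and> f3 \<in> carrier_mat r3 (dim_row C) \<and>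
      f3 * e3 = 1\<^sub>m r3 \<and> C * (x * y) = (e3 * f3) * C"
proof (intro exI conjI)
  show "C * (x * y) = (0\<^sub>m k 0 * 0\<^sub>m 0 k) * C"
    using assms C x y assoc_mult_mat[OF C x y] by simp
qed (use C in auto)

text \<open>If \<open>x\<close> comes from \<open>u\<close>, then \<open>u\<close> and the pulled
  back functional \<open>y * A\<close> split a line off the source, while \<open>C\<close> kills
  \<open>x\<close> and the sink contributes nothing. Together with the two lemmas that follow this
  gives summands of dimension (1,1,0), (0,1,0) and (0,1,1) along source, centre and sink.\<close>

lemma projection_extends_image:
  assumes u: "u \<in> carrier_mat m 1" and xu: "x = A * u"
  shows "projection_extends A C x y"
  unfolding projection_extends_def
proof
  have "A * (u * (y * A)) = (x * y) * A"
    unfolding xu using assoc_mult_mat[OF A u mult_carrier_mat[OF y A]]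
      assoc_mult_mat[OF mult_carrier_mat[OF A u] y A] by simp
  moreover have "(y * A) * u = 1\<^sub>m 1" using yx xu assoc_mult_mat[OF y A u] by simp
  ultimately show "\<exists>r1 e1 f1. r1 \<le> 1 \<and> e1 \<in> carrier_mat (dim_col A) r1 \<and> f1 \<in> carrier_mat r1 (dim_col A) \<and>
      f1 * e1 = 1\<^sub>m r1 \<and> A * (e1 * f1) = (x * y) * A"
    using A u y by (intro exI[of _ 1] exI[of _ u] exI[of _ "y * A"]) auto
  have "C * x = 0\<^sub>m k 1" using CA u assoc_mult_mat[OF C A u] by (simp add: xu)
  then show "\<exists>r3 e3 f3. r3 \<le> 1 \<and> e3 \<in> carrier_mat (dim_row C) r3 \<and> f3 \<in> carrier_mat r3 (dim_row C) \<and>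
      f3 * e3 = 1\<^sub>m r3 \<and> C * (x * y) = (e3 * f3) * C" by (rule extend_sink_zero)
qed

lemma projection_extends_kernel:
  assumes "y * A = 0\<^sub>m 1 m" "C * x = 0\<^sub>m k 1"
  shows "projection_extends A C x y"
  unfolding projection_extends_def using extend_source_zero[OF assms(1)] extend_sink_zero[OF assms(2)] by blast

text \<open>Dual case: since \<open>y\<close> factors through \<open>C\<close>, it vanishes on the
  image of \<open>A\<close>, and \<open>C * x\<close> spans the line split off at the sink.\<close>

lemma projection_extends_coimage:
  assumes u: "u \<in> carrier_mat 1 k" and yu: "y = u * C"
  shows "projection_extends A C x y"
  unfolding projection_extends_def
proof
  have "y * A = 0\<^sub>m 1 m" using CA u assoc_mult_mat[OF u C A] by (simp add: yu)
  then show "\<exists>r1 e1 f1. r1 \<le> 1 \<and> e1 \<in> carrier_mat (dim_col A) r1 \<and> f1 \<in> carrier_mat r1 (dim_col A) \<and>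
      f1 * e1 = 1\<^sub>m r1 \<and> A * (e1 * f1) = (x * y) * A" by (rule extend_source_zero)
  have "C * (x * y) = ((C * x) * u) * C"
    unfolding yu using assoc_mult_mat[OF C x mult_carrier_mat[OF u C]]
      assoc_mult_mat[OF mult_carrier_mat[OF C x] u C] by simp
  moreover have "u * (C * x) = 1\<^sub>m 1" using yx yu assoc_mult_mat[OF u C x] by simp
  ultimately show "\<exists>r3 e3 f3. r3 \<le> 1 \<and> e3 \<in> carrier_mat (dim_row C) r3 \<and> f3 \<in> carrier_mat r3 (dim_row C) \<and>
      f3 * e3 = 1\<^sub>m r3 \<and> C * (x * y) = (e3 * f3) * C"
    using C x u by (intro exI[of _ 1] exI[of _ "C * x"] exI[of _ u]) auto
qed

end

section \<open>Adapted lines for one flag and for two\<close>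

lemma nonzero_mat_entry:
  fixes A :: "'a::zero mat"
  assumes "A \<in> carrier_mat n m" "A \<noteq> 0\<^sub>m n m"
  obtains i j where "i < n" "j < m" "A $$ (i, j) \<noteq> 0"
  using assms by (metis carrier_matD eq_matI index_zero_mat)

text \<open>A matrix without columns has zero column space, from which the alternative separates
  every nonzero vector.\<close>

lemma ex_dual_functional:
  fixes x :: "complex mat"
  assumes x: "x \<in> carrier_mat n 1" "x \<noteq> 0\<^sub>m n 1"
  obtains y where "y \<in> carrier_mat 1 n" "y * x = 1\<^sub>m 1"
proof -
  have "0\<^sub>m n 0 * u = 0\<^sub>m n 1" if "u \<in> carrier_mat 0 1" for u :: "complex mat"
    using that by auto
  then show thesis using fredholm_alternative[of "0\<^sub>m n 0" n 0 x] x that by auto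
qed

text \<open>
  The set \<open>S\<close> is the first nonzero member of the flag of subspaces \<open>im A \<subseteq> ker C \<subseteq> V\<close>.
\<close>

lemma ex_extendable_vectors:
  assumes A: "A \<in> carrier_mat n m" and C: "C \<in> carrier_mat k n" and CA: "C * A = 0\<^sub>m k m" and n: "0 < n"
  obtains S where "S \<subseteq> carrier_mat n 1" "\<exists>x\<in>S. x \<noteq> 0\<^sub>m n 1"
    "\<And>x y. x \<in> S \<Longrightarrow> y \<in> carrier_mat 1 n \<Longrightarrow> y * x = 1\<^sub>m 1 \<Longrightarrow> projection_extends A C x y"
proof (cases "A = 0\<^sub>m n m")
  case False
  then obtain i j where ij: "i < n" "j < m" "A $$ (i, j) \<noteq> 0" using nonzero_mat_entry[OF A] by auto
  let ?u = "mat m 1 (\<lambda>(l, _). if l = j then 1 else 0) :: complex mat"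
  have "(A * ?u) $$ (i, 0) = A $$ (i, j)"
    using ij A by (simp add: scalar_prod_def if_distrib[of "\<lambda>z. _ * z"] sum.delta cong: if_cong)
  then have "A * ?u \<noteq> 0\<^sub>m n 1" using ij by auto
  then have "\<exists>x\<in>(\<lambda>u. A * u) ` carrier_mat m 1. x \<noteq> 0\<^sub>m n 1" by (intro bexI[of _ "A * ?u"]) auto
  moreover have "projection_extends A C x y"
    if "x \<in> (\<lambda>u. A * u) ` carrier_mat m 1" "y \<in> carrier_mat 1 n" "y * x = 1\<^sub>m 1" for x y
    using that A projection_extends_image[OF A C CA _ that(2,3)] by auto
  ultimately show thesis using A by (intro that[of "(\<lambda>u. A * u) ` carrier_mat m 1"]) auto
next
  case A0: True
  then have yA: "y * A = 0\<^sub>m 1 m" if "y \<in> carrier_mat 1 n" for y using that by simp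
  show thesis
  proof (cases "\<exists>x\<in>carrier_mat n 1. C * x = 0\<^sub>m k 1 \<and> x \<noteq> 0\<^sub>m n 1")
    case True
    moreover have "projection_extends A C x y"
      if "x \<in> {x \<in> carrier_mat n 1. C * x = 0\<^sub>m k 1}" "y \<in> carrier_mat 1 n" "y * x = 1\<^sub>m 1" for x y
      using projection_extends_kernel[OF A C CA _ that(2,3) yA[OF that(2)]] that(1) by blast
    ultimately show thesis by (intro that[of "{x \<in> carrier_mat n 1. C * x = 0\<^sub>m k 1}"]) blast+
  next
    case False
    \<comment> \<open>Here the kernel of \<open>C\<close> is zero, so every functional factors
      through \<open>C\<close>; transposition turns this factorisation into a column system for the
      alternative.\<close>
    have "projection_extends A C x y"
      if x: "x \<in> carrier_mat n 1" and y: "y \<in> carrier_mat 1 n" and yx: "y * x = 1\<^sub>m 1" for x y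
    proof -
      have Ct: "C\<^sup>T \<in> carrier_mat n k" and yt: "y\<^sup>T \<in> carrier_mat n 1" using C y by auto
      have "\<not> (\<exists>z\<in>carrier_mat 1 n. z * C\<^sup>T = 0\<^sub>m 1 k \<and> z * y\<^sup>T = 1\<^sub>m 1)"
      proof clarify
        fix z :: "complex mat" assume z: "z \<in> carrier_mat 1 n" "z * C\<^sup>T = 0\<^sub>m 1 k" "z * y\<^sup>T = 1\<^sub>m 1"
        then have "C * z\<^sup>T = 0\<^sub>m k 1" "z\<^sup>T \<in> carrier_mat n 1"
          using transpose_mult[OF z(1) Ct] by simp_all
        then have "z\<^sup>T = 0\<^sub>m n 1" using False by blast
        then have "z = 0\<^sub>m 1 n" by (metis transpose_transpose zero_transpose_mat)
        then have "z * y\<^sup>T = 0\<^sub>m 1 1" using yt by simp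
        then have "1\<^sub>m 1 $$ (0, 0) = (0\<^sub>m 1 1 $$ (0, 0) :: complex)" unfolding z(3) by (rule arg_cong)
        then show False by simp
      qed
      then obtain u where u: "u \<in> carrier_mat k 1" "y\<^sup>T = C\<^sup>T * u"
        using fredholm_alternative[OF Ct yt] by blast
      have "y = (C\<^sup>T * u)\<^sup>T" unfolding u(2)[symmetric] by simp
      then have "y = u\<^sup>T * C" using transpose_mult[OF Ct u(1)] by simp
      then show ?thesis using projection_extends_coimage[OF A C CA x y yx, of "u\<^sup>T"] u by simp
    qed
    moreover have "mat n 1 (\<lambda>_. 1) \<noteq> (0\<^sub>m n 1 :: complex mat)"
    proof
      assume "mat n 1 (\<lambda>_. 1) = (0\<^sub>m n 1 :: complex mat)"
      then have "mat n 1 (\<lambda>_. 1) $$ (0, 0) = (0\<^sub>m n 1 $$ (0, 0) :: complex)" by (rule arg_cong)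
      then show False using n by simp
    qed
    ultimately show thesis by (intro that[of "carrier_mat n 1"]) (auto intro: bexI[of _ "mat n 1 (\<lambda>_. 1)"])
  qed
qed

text \<open>
  Two flags \<open>im A \<subseteq> ker C \<subseteq> V\<close> and \<open>im B \<subseteq> ker D \<subseteq> V\<close> always have a common adapted splitting of a line:
  \<open>x\<close> is taken in the intersection of the smallest members that meet nontrivially.
\<close>

lemma ex_common_projection:
  assumes A: "A \<in> carrier_mat n m" and C: "C \<in> carrier_mat k n" and CA: "C * A = 0\<^sub>m k m"
    and B: "B \<in> carrier_mat n m'" and D: "D \<in> carrier_mat k' n" and DB: "D * B = 0\<^sub>m k' m'" and n: "0 < n"
  obtains x y where "x \<in> carrier_mat n 1" "y \<in> carrier_mat 1 n" "y * x = 1\<^sub>m 1"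
    "projection_extends A C x y" "projection_extends B D x y"
proof -
  obtain S where S: "S \<subseteq> carrier_mat n 1" "\<exists>x\<in>S. x \<noteq> 0\<^sub>m n 1"
    "\<And>x y. x \<in> S \<Longrightarrow> y \<in> carrier_mat 1 n \<Longrightarrow> y * x = 1\<^sub>m 1 \<Longrightarrow> projection_extends A C x y"
    using ex_extendable_vectors[OF A C CA n] by metis
  have "\<exists>x\<in>S. \<exists>y\<in>carrier_mat 1 n. y * x = 1\<^sub>m 1 \<and> projection_extends B D x y"
  proof (cases "\<exists>x\<in>S. x \<noteq> 0\<^sub>m n 1 \<and> (\<exists>u\<in>carrier_mat m' 1. x = B * u)")
    case True
    then obtain x u where x: "x \<in> S" "x \<noteq> 0\<^sub>m n 1" "u \<in> carrier_mat m' 1" "x = B * u" by blast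
    then have xc: "x \<in> carrier_mat n 1" using S by blast
    obtain y where "y \<in> carrier_mat 1 n" "y * x = 1\<^sub>m 1" by (rule ex_dual_functional[OF xc x(2)])
    then show ?thesis using projection_extends_image[OF B D DB xc _ _ x(3,4)] x(1) by blast
  next
    case noim: False
    show ?thesis
    proof (cases "\<exists>x\<in>S. x \<noteq> 0\<^sub>m n 1 \<and> D * x = 0\<^sub>m k' 1")
      case True
      then obtain x where x: "x \<in> S" "x \<noteq> 0\<^sub>m n 1" "D * x = 0\<^sub>m k' 1" by blast
      then have xc: "x \<in> carrier_mat n 1" using S by blast
      have "\<not> (\<exists>u\<in>carrier_mat m' 1. x = B * u)" using noim x(1,2) by blast
      \<comment> \<open>\<open>x\<close> lies outside the image of \<open>B\<close>, so some
        functional kills that image and is 1 on \<open>x\<close>.\<close>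
      then obtain y where "y \<in> carrier_mat 1 n" "y * B = 0\<^sub>m 1 m'" "y * x = 1\<^sub>m 1"
        using fredholm_alternative[OF B xc] by blast
      then show ?thesis using projection_extends_kernel[OF B D DB xc _ _ _ x(3)] x(1) by blast
    next
      case False
      obtain x where x: "x \<in> S" "x \<noteq> 0\<^sub>m n 1" using S by blast
      then have xc: "x \<in> carrier_mat n 1" using S by blast
      have "D * x \<noteq> 0\<^sub>m k' 1" using False x by blast
      moreover have Dx: "D * x \<in> carrier_mat k' 1" using D xc by auto
      ultimately obtain u where u: "u \<in> carrier_mat 1 k'" "u * (D * x) = 1\<^sub>m 1"
        using ex_dual_functional[OF Dx] by blast
      then have "u * D * x = 1\<^sub>m 1" "u * D \<in> carrier_mat 1 n" using assoc_mult_mat[OF u(1) D xc] D by auto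
      then show ?thesis using projection_extends_coimage[OF B D DB xc _ _ u(1) refl] x(1) by blast
    qed
  qed
  then show thesis using S that by (meson subsetD)
qed

text \<open>A nonzero centre contains a line adapted to both flags; it splits off a summand of
  dimension at most one everywhere, which must be the whole indecomposable. If the centre is zero,
  all maps are empty and a single line at some vertex \<open>k\<close> splits off.\<close>

lemma star_indecomposable_dim:
  assumes X: "(d, M) \<in> indecomposables star star_ideal" and i: "i \<in> verts star"
  shows "d i \<le> 1"
proof (cases "d 0 = 0")
  case False
  have "M \<in> rep_variety star star_ideal d" using X by (simp add: indecomposables_def reps_def)
  then have M: "M \<in> rep_tuples star d" "M 3 * M 1 = 0\<^sub>m (d 3) (d 1)" "M 4 * M 2 = 0\<^sub>m (d 4) (d 2)"
    by (simp_all add: star_rep_variety_iff)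
  have c: "M 1 \<in> carrier_mat (d 0) (d 1)" "M 2 \<in> carrier_mat (d 0) (d 2)"
    "M 3 \<in> carrier_mat (d 3) (d 0)" "M 4 \<in> carrier_mat (d 4) (d 0)"
    using rep_tuples_carrier[OF M(1), of 1] rep_tuples_carrier[OF M(1), of 2]
      rep_tuples_carrier[OF M(1), of 3] rep_tuples_carrier[OF M(1), of 4] by auto
  obtain x y where xy: "x \<in> carrier_mat (d 0) 1" "y \<in> carrier_mat 1 (d 0)" "y * x = 1\<^sub>m 1"
    and "projection_extends (M 1) (M 3) x y" "projection_extends (M 2) (M 4) x y"
    using ex_common_projection[OF c(1,3) M(2) c(2,4) M(3)] False by blast
  then obtain r1 e1 f1 r2 e2 f2 r3 e3 f3 r4 e4 f4 where
    1: "r1 \<le> 1" "e1 \<in> carrier_mat (d 1) r1" "f1 \<in> carrier_mat r1 (d 1)" "f1 * e1 = 1\<^sub>m r1" "M 1 * (e1 * f1) = (x * y) * M 1" and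
    2: "r2 \<le> 1" "e2 \<in> carrier_mat (d 2) r2" "f2 \<in> carrier_mat r2 (d 2)" "f2 * e2 = 1\<^sub>m r2" "M 2 * (e2 * f2) = (x * y) * M 2" and
    3: "r3 \<le> 1" "e3 \<in> carrier_mat (d 3) r3" "f3 \<in> carrier_mat r3 (d 3)" "f3 * e3 = 1\<^sub>m r3" "M 3 * (x * y) = (e3 * f3) * M 3" and
    4: "r4 \<le> 1" "e4 \<in> carrier_mat (d 4) r4" "f4 \<in> carrier_mat r4 (d 4)" "f4 * e4 = 1\<^sub>m r4" "M 4 * (x * y) = (e4 * f4) * M 4"
    using c unfolding projection_extends_def by (auto simp only: carrier_matD)
  define r where "r = (!) [1, r1, r2, r3, r4]"
  define e where "e = (!) [x, e1, e2, e3, e4]"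
  define f where "f = (!) [y, f1, f2, f3, f4]"
  have "rep_retract star d M r e f"
    using xy 1 2 3 4 by (simp add: rep_retract_def r_def e_def f_def)
  moreover have "r j \<le> 1" if "j \<in> verts star" for j using that 1 2 3 4 by (auto simp: r_def)
  moreover have "r 0 = 1" by (simp add: r_def)
  ultimately show ?thesis using star.indecomposable_retract[OF X, of r e f] i by fastforce
next
  case d0: True
  have "M \<in> rep_tuples star d" using X by (simp add: indecomposables_def reps_def rep_variety_def)
  note Mc = rep_tuples_carrier[OF this]
  have "\<not> zero_rep star (d, M)" using X by (simp add: indecomposables_def)
  then obtain k where k: "k \<in> verts star" "d k \<noteq> 0" by (auto simp: zero_rep_def)
  define r where "r j = (if j = k then 1 else 0 :: nat)" for j
  define e where "e j = mat (d j) (r j) (\<lambda>(i, _). if i = 0 then 1 else 0 :: complex)" for j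
  define f where "f j = mat (r j) (d j) (\<lambda>(_, i). if i = 0 then 1 else 0 :: complex)" for j
  have "f j * e j = 1\<^sub>m (r j)" for j
    using k(2) by (intro eq_matI) (auto simp: e_def f_def r_def scalar_prod_def if_distrib[of "\<lambda>z. _ * z"] sum.delta cong: if_cong split: if_splits)
  moreover have "M a * (e (tail star a) * f (tail star a)) = (e (head star a) * f (head star a)) * M a"
    if "a \<in> arcs star" for a
    using Mc[OF that] d0 by (intro eq_matI) (auto simp: e_def f_def split: if_splits)
  ultimately have "rep_retract star d M r e f" by (auto simp: rep_retract_def e_def f_def)
  then have "d i = r i"
    using star.indecomposable_retract[OF X, of r e f] i k by (auto simp: r_def)
  then show ?thesis by (simp add: r_def)
qed

section \<open>Counting isomorphism classes\<close>

lemma finite_quotientI: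
  assumes "equiv S r" "finite (F ` S)" "\<And>x y. x \<in> S \<Longrightarrow> y \<in> S \<Longrightarrow> F x = F y \<Longrightarrow> (x, y) \<in> r"
  shows "finite (S // r)"
proof -
  have "S // r \<subseteq> (\<lambda>c. r `` {SOME x. x \<in> S \<and> F x = c}) ` F ` S"
  proof
    fix Z assume "Z \<in> S // r"
    then obtain x where x: "x \<in> S" "Z = r `` {x}" by (auto simp: quotient_def)
    let ?z = "SOME z. z \<in> S \<and> F z = F x"
    have "?z \<in> S \<and> F ?z = F x" by (rule someI[of _ x]) (use x in simp)
    then have "(?z, x) \<in> r" using assms(3) x by blast
    then have "Z = r `` {?z}" using x assms(1) by (metis equiv_class_eq)
    then show "Z \<in> (\<lambda>c. r `` {SOME x. x \<in> S \<and> F x = c}) ` F ` S" using x by blast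
  qed
  then show ?thesis using assms(2) finite_subset by blast
qed

lemma (in wf_digraph) equiv_rep_iso_indecomposables:
  "equiv (indecomposables G I) (rep_iso G \<inter> indecomposables G I \<times> indecomposables G I)"
proof -
  have t: "M \<in> rep_tuples G d" if "(d, M) \<in> indecomposables G I" for d M
    using that by (auto simp: indecomposables_def reps_def rep_variety_def)
  show ?thesis
  proof (rule equivI)
    show "refl_on (indecomposables G I) (rep_iso G \<inter> indecomposables G I \<times> indecomposables G I)"
    proof (rule refl_onI, clarify)
      fix d M assume X: "(d, M) \<in> indecomposables G I"
      let ?g = "\<lambda>i\<in>verts G. 1\<^sub>m (d i)"
      have "?g \<in> GL_bullet G d" by (auto simp: GL_bullet_def Units_mat_ring)
      moreover have "?g (head G a) * M a = M a * ?g (tail G a)" if "a \<in> arcs G" for a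
        using rep_tuples_carrier[OF t[OF X] that] that by simp
      ultimately have "((d, M), (d, M)) \<in> rep_iso G" unfolding rep_iso_iff[OF t[OF X] t[OF X]] by blast
      then show "((d, M), (d, M)) \<in> rep_iso G \<inter> indecomposables G I \<times> indecomposables G I" using X by blast
    qed
    show "sym (rep_iso G \<inter> indecomposables G I \<times> indecomposables G I)"
      using rep_iso_sym t by (auto intro!: symI)
    show "trans (rep_iso G \<inter> indecomposables G I \<times> indecomposables G I)"
    proof (intro transI, clarify)
      fix d M d' N d'' L
      assume X: "(d, M) \<in> indecomposables G I" "(d', N) \<in> indecomposables G I" "(d'', L) \<in> indecomposables G I"
        and "((d, M), (d', N)) \<in> rep_iso G" "((d', N), (d'', L)) \<in> rep_iso G"
      then have "((d, M), (d'', L)) \<in> rep_iso G" using rep_iso_trans[OF t t t] by blast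
      then show "((d, M), (d'', L)) \<in> rep_iso G \<inter> indecomposables G I \<times> indecomposables G I"
        using X by blast
    qed
  qed auto
qed

text \<open>
  The star is a tree, so by rescaling the outer vertices every matrix of size at most one can be
  normalised to \<open>0\<close> or \<open>1\<close>; only the dimensions and the zero pattern of the entries matter.
\<close>

lemma star_rep_isoI:
  assumes M: "M \<in> rep_tuples star d" and N: "N \<in> rep_tuples star d'"
    and d: "\<And>i. i \<in> verts star \<Longrightarrow> d i = d' i" "\<And>i. i \<in> verts star \<Longrightarrow> d i \<le> 1"
    and nz: "\<And>a. a \<in> arcs star \<Longrightarrow> d a = 1 \<Longrightarrow> d 0 = 1 \<Longrightarrow> M a $$ (0, 0) = 0 \<longleftrightarrow> N a $$ (0, 0) = 0"
  shows "((d, M), (d', N)) \<in> rep_iso star"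
proof -
  \<comment> \<open>With the identity at the centre, an incoming arrow asks for
    \<open>M i = N i * s i\<close> and an outgoing one for \<open>s i * M i = N i\<close>. The value
    1 serves where entries vanish. At a vertex of dimension 0 the entry is meaningless, but only
    \<open>s i \<noteq> 0\<close> matters there.\<close>
  define s where "s i = (if i = 0 \<or> M i $$ (0, 0) = 0 \<or> N i $$ (0, 0) = 0 then 1 else
    if i \<le> 2 then M i $$ (0, 0) / N i $$ (0, 0) else N i $$ (0, 0) / M i $$ (0, 0))" for i
  have s: "s i \<noteq> 0" for i by (simp add: s_def)
  define g where "g = (\<lambda>i\<in>verts star. s i \<cdot>\<^sub>m 1\<^sub>m (d i))"
  have "s i \<cdot>\<^sub>m 1\<^sub>m (d i) \<in> Units (mat_ring (d i))" for i
    unfolding Units_mat_ring using s[of i] by (auto intro!: bexI[of _ "inverse (s i) \<cdot>\<^sub>m 1\<^sub>m (d i)"] eq_matI simp: mult_smult_distrib mult_smult_assoc_mat)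
  then have "g \<in> GL_bullet star d" by (auto simp: GL_bullet_def g_def)
  moreover have "g (head star a) * M a = N a * g (tail star a)" if a: "a \<in> arcs star" for a
  proof -
    let ?h = "head star a" and ?t = "tail star a"
    have v: "?h \<in> verts star" "?t \<in> verts star" using a star.head_in_verts star.tail_in_verts by blast+
    have c: "M a \<in> carrier_mat (d ?h) (d ?t)" "N a \<in> carrier_mat (d ?h) (d ?t)"
      using rep_tuples_carrier[OF M a] rep_tuples_carrier[OF N a] d(1)[OF v(1)] d(1)[OF v(2)] by auto
    have gM: "g ?h * M a = s ?h \<cdot>\<^sub>m M a" "N a * g ?t = s ?t \<cdot>\<^sub>m N a"
      using v c unfolding g_def by (simp_all del: star_simps add: mult_smult_assoc_mat[OF one_carrier_mat c(1)] mult_smult_distrib[OF c(2) one_carrier_mat])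
    have "s ?h * M a $$ (i, j) = s ?t * N a $$ (i, j)" if ij: "i < d ?h" "j < d ?t" for i j
    proof -
      have 0: "i = 0" "j = 0" "d ?h = 1" "d ?t = 1" using ij d(2)[OF v(1)] d(2)[OF v(2)] by auto
      then have "M a $$ (0, 0) = 0 \<longleftrightarrow> N a $$ (0, 0) = 0" using nz[OF a] a by auto
      then show ?thesis using a by (auto simp: 0(1,2) s_def)
    qed
    then show ?thesis unfolding gM using c by (intro eq_matI) auto
  qed
  ultimately show ?thesis unfolding star.rep_iso_iff[OF M N] using d(1) by blast
qed

lemma finite_rep_type_star: "finite_rep_type star star_ideal"
proof -
  \<comment> \<open>Entries of empty matrices have no meaning, so \<open>F\<close> may fail to be
    constant on isomorphism classes; what counts is that equal values force isomorphism.\<close>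
  define F :: "(nat, nat) rep \<Rightarrow> nat set \<times> nat set" where
    "F X = ({i \<in> verts star. fst X i = 1}, {a \<in> arcs star. snd X a $$ (0, 0) = 0})" for X
  have t: "M \<in> rep_tuples star d" if "(d, M) \<in> indecomposables star star_ideal" for d M
    using that by (auto simp: indecomposables_def reps_def rep_variety_def)
  have "F ` indecomposables star star_ideal \<subseteq> Pow (verts star) \<times> Pow (arcs star)" by (auto simp: F_def)
  then have fin: "finite (F ` indecomposables star star_ideal)"
    by (rule finite_subset) (intro finite_cartesian_product finite_Pow_iff[THEN iffD2] star.finite_verts star.finite_arcs)
  show ?thesis unfolding finite_rep_type_def
  proof (rule finite_quotientI[OF star.equiv_rep_iso_indecomposables fin])
    fix X Y assume X: "X \<in> indecomposables star star_ideal" and Y: "Y \<in> indecomposables star star_ideal"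
      and FXY: "F X = F Y"
    obtain d M d' N where XY: "X = (d, M)" "Y = (d', N)" by fastforce
    have d: "d i \<le> 1" "d' i \<le> 1" if "i \<in> verts star" for i
      using star_indecomposable_dim[OF _ that] X Y by (auto simp: XY)
    have "(d i = 1) = (d' i = 1)" if "i \<in> verts star" for i
      using FXY that unfolding F_def XY prod.inject fst_conv by blast
    then have dd: "d i = d' i" if "i \<in> verts star" for i using d[OF that] that by (metis le_neq_implies_less less_one)
    have "(M a $$ (0, 0) = 0) = (N a $$ (0, 0) = 0)" if "a \<in> arcs star" for a
      using FXY that unfolding F_def XY prod.inject snd_conv by blast
    then have "(X, Y) \<in> rep_iso star"
      unfolding XY using t X Y dd d by (intro star_rep_isoI) (auto simp only: XY)
    then show "(X, Y) \<in> rep_iso star \<inter> indecomposables star star_ideal \<times> indecomposables star star_ideal"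
      using X Y by blast
  qed
qed

section \<open>Degenerations\<close>

lemma (in wf_digraph) act_rep_tuples:
  assumes g: "g \<in> GL_bullet G d" and M: "M \<in> rep_tuples G d"
  shows "act G d g M \<in> rep_tuples G d"
proof -
  have "g (head G a) * M a * inv\<^bsub>mat_ring (d (tail G a))\<^esub> (g (tail G a)) \<in> carrier_mat (d (head G a)) (d (tail G a))"
    if a: "a \<in> arcs G" for a
    using mat_ring_inv(1)[OF GL_bullet_Units[OF g tail_in_verts[OF a]]] rep_tuples_carrier[OF M a]
      GL_bullet_carrier[OF g head_in_verts[OF a]] by (meson mult_carrier_mat)
  then show ?thesis by (auto simp: act_def rep_tuples_def)
qed

lemma poly_functions_curve:
  assumes "f \<in> poly_functions Q d"
    and "\<And>a i j. a \<in> arcs Q \<Longrightarrow> i < d (head Q a) \<Longrightarrow> j < d (tail Q a) \<Longrightarrow> \<exists>p. \<forall>t. c t a $$ (i, j) = poly p t"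
  shows "\<exists>p. \<forall>t. f (c t) = poly p t"
  using assms(1)
proof induction
  case (const z)
  show ?case by (rule exI[of _ "[:z:]"]) simp
next
  case (coord a i j)
  then show ?case by (rule assms(2))
next
  case (add f g)
  then show ?case by (metis poly_add)
next
  case (mult f g)
  then show ?case by (metis poly_mult)
qed

text \<open>Along a polynomial curve each equation of a closed set becomes a polynomial in
  \<open>t\<close>. If it vanishes for all \<open>t \<noteq> 0\<close>, it has infinitely many roots
  and vanishes at 0 too.\<close>

lemma deg_le_curve:
  assumes c: "\<And>a i j. a \<in> arcs Q \<Longrightarrow> i < d (head Q a) \<Longrightarrow> j < d (tail Q a) \<Longrightarrow> \<exists>p. \<forall>t. c t a $$ (i, j) = poly p t"
    and orbit: "\<And>t. t \<noteq> 0 \<Longrightarrow> \<exists>g\<in>GL_bullet Q d. c t = act Q d g M" and c0: "c 0 \<in> rep_tuples Q d"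
  shows "deg_le Q d M (c 0)"
  unfolding deg_le_def hull_def
proof
  fix Z assume "Z \<in> {Z. zariski_closed Q d Z \<and> (\<lambda>g. act Q d g M) ` GL_bullet Q d \<subseteq> Z}"
  then obtain F where F: "F \<subseteq> poly_functions Q d" "Z = {M \<in> rep_tuples Q d. \<forall>f\<in>F. f M = 0}"
    and sub: "(\<lambda>g. act Q d g M) ` GL_bullet Q d \<subseteq> Z" by (auto simp: zariski_closed_def)
  have "f (c 0) = 0" if f: "f \<in> F" for f
  proof -
    obtain p where p: "\<And>t. f (c t) = poly p t" using poly_functions_curve[of f Q d c] c f F(1) by blast
    have "poly p t = 0" if "t \<noteq> 0" for t
    proof -
      obtain g where g: "g \<in> GL_bullet Q d" "c t = act Q d g M" using orbit[OF \<open>t \<noteq> 0\<close>] by blast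
      then have "c t \<in> Z" using sub by auto
      then have "f (c t) = 0" using F(2) f by blast
      then show ?thesis using p[of t] by simp
    qed
    then have "- {0} \<subseteq> {t. poly p t = 0}" by auto
    moreover have "infinite (- {0 :: complex})" by (simp add: infinite_UNIV_char_0 Compl_eq_Diff_UNIV)
    ultimately have "p = 0" using poly_roots_finite finite_subset by blast
    then show ?thesis by (simp add: p)
  qed
  then show "c 0 \<in> Z" using F(2) c0 by simp
qed


section \<open>Two lines in the hyperbolic plane\<close>

definition star_dim :: "nat \<Rightarrow> nat" where
  "star_dim i = (if i = 0 then 2 else 1)"

text \<open>Orthogonal sum of three hyperbolic planes: the centre, the vertices 1 and 3, and the
  vertices 2 and 4.\<close>

definition star_form :: "nat form" where
  "star_form v w = v 0 $ 0 * w 0 $ 1 + v 0 $ 1 * w 0 $ 0 +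
     v 1 $ 0 * w 3 $ 0 + v 3 $ 0 * w 1 $ 0 + v 2 $ 0 * w 4 $ 0 + v 4 $ 0 * w 2 $ 0"

text \<open>The first line is fixed as the span of (1, 0), and the row at 3 is minus the pairing
  with this vector. The row at 4 has its own parameters \<open>r\<close> and \<open>s\<close>,
  because the degeneration passes through points that are not symmetric.\<close>

definition star_rep :: "complex \<Rightarrow> complex \<Rightarrow> complex \<Rightarrow> complex \<Rightarrow> nat \<Rightarrow> complex mat" where
  "star_rep p q r s = (\<lambda>a\<in>arcs star.
     if a = 1 then mat 2 1 (\<lambda>(i, _). if i = 0 then 1 else 0)
     else if a = 2 then mat 2 1 (\<lambda>(i, _). if i = 0 then p else q)
     else if a = 3 then mat 1 2 (\<lambda>(_, j). if j = 0 then 0 else -1)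
     else mat 1 2 (\<lambda>(_, j). if j = 0 then r else s))"

lemma star_dim_simps [simp]: "star_dim 0 = 2" "star_dim 1 = 1" "star_dim (Suc 0) = 1" "star_dim 2 = 1"
  "star_dim 3 = 1" "star_dim 4 = 1"
  by (simp_all add: star_dim_def)

lemma star_rep_simps [simp]:
  "star_rep p q r s 1 = mat 2 1 (\<lambda>(i, _). if i = 0 then 1 else 0)"
  "star_rep p q r s (Suc 0) = mat 2 1 (\<lambda>(i, _). if i = 0 then 1 else 0)"
  "star_rep p q r s 2 = mat 2 1 (\<lambda>(i, _). if i = 0 then p else q)"
  "star_rep p q r s 3 = mat 1 2 (\<lambda>(_, j). if j = 0 then 0 else -1)"
  "star_rep p q r s 4 = mat 1 2 (\<lambda>(_, j). if j = 0 then r else s)"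
  by (simp_all add: star_rep_def)

lemma star_rep_tuples: "star_rep p q r s \<in> rep_tuples star star_dim"
  by (auto simp: rep_tuples_def star_rep_def star_dim_def)

lemma sum_upt_2: "(\<Sum>i = 0..<2. f i) = f 0 + f (1::nat)" for f :: "nat \<Rightarrow> complex"
  by (simp add: numeral_2_eq_2)

lemma star_rep_variety:
  assumes "r * p + s * q = 0"
  shows "star_rep p q r s \<in> rep_variety star star_ideal star_dim"
  unfolding star_rep_variety_iff using assms star_rep_tuples
  by (auto intro!: eq_matI simp: scalar_prod_def sum_upt_2)

lemma graded_space_star:
  assumes "v \<in> graded_space star star_dim"
  shows "v 0 \<in> carrier_vec 2" "v 1 \<in> carrier_vec 1" "v 2 \<in> carrier_vec 1" "v 3 \<in> carrier_vec 1" "v 4 \<in> carrier_vec 1"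
  using assms by (auto simp: graded_space_def PiE_iff dest: bspec)

lemma star_arcs_into:
  "{a \<in> arcs star. head star a = 0} = {1, 2}" "{a \<in> arcs star. head star a = 1} = {}"
  "{a \<in> arcs star. head star a = 2} = {}" "{a \<in> arcs star. head star a = 3} = {3}"
  "{a \<in> arcs star. head star a = 4} = {4}"
  by auto

text \<open>The row \<open>(- q, - p)\<close> is minus the pairing with the vector (p, q), as
  symmetry demands, and \<open>p * q = 0\<close> says that this vector is isotropic.\<close>

lemma star_rep_symmetric:
  assumes "p * q = 0"
  shows "star_rep p q (- q) (- p) \<in> symmetric_rep_variety star star_ideal star_dim star_form"
    (is "?M \<in> _")
proof -
  have app: "rep_apply star star_dim ?M v 0 $ 0 = v 1 $ 0 + p * v 2 $ 0"
    "rep_apply star star_dim ?M v 0 $ 1 = q * v 2 $ 0"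
    "rep_apply star star_dim ?M v 1 $ 0 = 0" "rep_apply star star_dim ?M v 2 $ 0 = 0"
    "rep_apply star star_dim ?M v 3 $ 0 = - v 0 $ 1"
    "rep_apply star star_dim ?M v 4 $ 0 = - q * v 0 $ 0 - p * v 0 $ 1"
    if v: "v \<in> graded_space star star_dim" for v
    using graded_space_star[OF v] unfolding rep_apply_def
    by (simp_all only: restrict_apply star_arcs_into) (simp_all add: scalar_prod_def sum_upt_2)
  have "star_form (rep_apply star star_dim ?M v) w + star_form v (rep_apply star star_dim ?M w) = 0"
    if v: "v \<in> graded_space star star_dim" and w: "w \<in> graded_space star star_dim" for v w
    unfolding star_form_def app[OF v] app[OF w] by (simp add: algebra_simps)
  moreover have "?M \<in> rep_variety star star_ideal star_dim"
    using assms by (intro star_rep_variety) (simp add: mult.commute)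
  ultimately show ?thesis by (simp add: symmetric_rep_variety_def)
qed

definition star_unit :: "nat \<Rightarrow> nat \<Rightarrow> nat \<Rightarrow> complex vec" where
  "star_unit i k = (\<lambda>j\<in>verts star. vec (star_dim j) (\<lambda>l. if j = i \<and> l = k then 1 else 0))"

lemma star_unit_space: "star_unit i k \<in> graded_space star star_dim"
  by (auto simp: graded_space_def star_unit_def)

lemma quadratic_space_star: "quadratic_space star star_flip star_dim 1 star_form"
proof -
  have "bilinear_form star star_dim star_form"
    unfolding bilinear_form_def
  proof (intro ballI allI)
    fix u v w c assume "u \<in> graded_space star star_dim" "v \<in> graded_space star star_dim" "w \<in> graded_space star star_dim"
    note c = graded_space_star[OF this(1)] graded_space_star[OF this(2)] graded_space_star[OF this(3)]
    show "star_form (graded_add star u v) w = star_form u w + star_form v w \<and>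
        star_form w (graded_add star u v) = star_form w u + star_form w v \<and>
        star_form (graded_smult star c v) w = c * star_form v w \<and>
        star_form w (graded_smult star c v) = c * star_form w v"
      using c by (simp add: star_form_def graded_add_def graded_smult_def algebra_simps)
  qed
  moreover have "v = graded_zero star star_dim"
    if v: "v \<in> graded_space star star_dim" and 0: "\<forall>w\<in>graded_space star star_dim. star_form v w = 0" for v
  proof -
    have "star_form v (star_unit i k) = 0" for i k using 0 star_unit_space by blast
    from this[of 0 0] this[of 0 1] this[of 1 0] this[of 2 0] this[of 3 0] this[of 4 0]
    have "v 0 $ 1 = 0" "v 0 $ 0 = 0" "v 3 $ 0 = 0" "v 4 $ 0 = 0" "v 1 $ 0 = 0" "v 2 $ 0 = 0"
      by (simp_all add: star_form_def star_unit_def)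
    then have "v i = 0\<^sub>v (star_dim i)" if "i \<in> verts star" for i
      using graded_space_star[OF v] that by (auto intro!: eq_vecI simp: less_2_cases_iff)
    then show ?thesis using v by (auto simp: graded_zero_def graded_space_def PiE_iff extensional_def fun_eq_iff)
  qed
  moreover have "star_form v w = 0"
    if ij: "i \<in> verts star" "j \<in> verts star" "j \<noteq> star_flip i"
      and v: "v \<in> graded_component star star_dim i" and w: "w \<in> graded_component star star_dim j" for i j v w
  proof -
    \<comment> \<open>Each term of the form joins a component to its flip, and one of the two
      factors lies outside the support of \<open>v\<close> or \<open>w\<close>.\<close>
    have "v k $ l * w (star_flip k) $ l' = 0"
      if k: "k \<in> verts star" and l: "l < star_dim k" "l' < star_dim (star_flip k)" for k l l'
    proof (cases "k = i")
      case True
      then have "star_flip k \<noteq> j" "star_flip k \<in> verts star" using ij by (auto simp: star_flip_def)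
      then show ?thesis using w l(2) unfolding graded_component_def by auto
    next
      case False
      then show ?thesis using v k l(1) unfolding graded_component_def by auto
    qed
    from this[of 0 0 1] this[of 0 1 0] this[of 1 0 0] this[of 2 0 0] this[of 3 0 0] this[of 4 0 0]
    show ?thesis by (auto simp: star_form_def star_flip_def)
  qed
  ultimately show ?thesis
    by (auto simp: quadratic_space_def star_form_def mult.commute simp del: star_simps)
qed

text \<open>The second line, spanned by (1, t), closes up on the first as \<open>t\<close> tends to
  0. It is isotropic only at \<open>t = 0\<close>, so the curve leaves the symmetric locus while
  still satisfying the relations.\<close>

lemma star_deg_le: "deg_le star star_dim (star_rep 0 1 (-1) 0) (star_rep 1 0 0 (-1))"
proof -
  let ?c = "\<lambda>t. star_rep 1 t t (-1)"
  have "\<exists>p. \<forall>t. ?c t a $$ (i, j) = poly p t"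
    if "a \<in> arcs star" "i < star_dim (head star a)" "j < star_dim (tail star a)" for a i j
  proof -
    have t: "\<exists>p. \<forall>t::complex. t = poly p t" by (rule exI[of _ "[:0, 1:]"]) simp
    have c: "\<exists>p. \<forall>t::complex. poly p t = c" "\<exists>p. \<forall>t::complex. c = poly p t" for c
      by (rule exI[of _ "[:c:]"], simp)+
    show ?thesis using that by (auto simp: less_2_cases_iff) (rule t c)+
  qed
  moreover have "\<exists>g\<in>GL_bullet star star_dim. ?c t = act star star_dim g (star_rep 0 1 (-1) 0)" if t: "t \<noteq> 0" for t
  proof -
    \<comment> \<open>At the centre the basis vectors go to (1, 0) and (1, t); the scalars
      \<open>t\<close> and \<open>- t\<close> at the sinks restore the normalisation of the two
      rows.\<close>
    define g where "g = (\<lambda>i\<in>verts star. if i = 0 then mat 2 2 (\<lambda>(i, j). if i = 0 then 1 else if j = 0 then 0 else t)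
      else if i = 3 then t \<cdot>\<^sub>m 1\<^sub>m 1 else if i = 4 then (- t) \<cdot>\<^sub>m 1\<^sub>m 1 else 1\<^sub>m 1)"
    have "mat 2 2 (\<lambda>(i, j). if i = 0 then 1 else if j = 0 then 0 else t) \<in> Units (mat_ring 2)"
      unfolding Units_mat_ring using t
      by (auto intro!: bexI[of _ "mat 2 2 (\<lambda>(i, j). if i = 0 then if j = 0 then 1 else - 1 / t else if j = 0 then 0 else 1 / t)"]
          eq_matI simp: scalar_prod_def sum_upt_2 less_2_cases_iff)
    moreover have "s \<cdot>\<^sub>m 1\<^sub>m 1 \<in> Units (mat_ring 1)" if "s \<noteq> 0" for s
      unfolding Units_mat_ring using that
      by (auto intro!: bexI[of _ "(1 / s) \<cdot>\<^sub>m 1\<^sub>m 1"] eq_matI simp: scalar_prod_def)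
    from this[of 1] this[of t] this[of "- t"] have
      "1\<^sub>m 1 \<in> Units (mat_ring 1)" "t \<cdot>\<^sub>m 1\<^sub>m 1 \<in> Units (mat_ring 1)" "(- t) \<cdot>\<^sub>m 1\<^sub>m 1 \<in> Units (mat_ring 1)"
      using t by (auto simp: Units_mat_ring)
    ultimately have g: "g \<in> GL_bullet star star_dim" by (auto simp: GL_bullet_def g_def)
    have "g (head star a) * star_rep 0 1 (-1) 0 a = ?c t a * g (tail star a)" if "a \<in> arcs star" for a
      using that by (auto intro!: eq_matI simp: g_def scalar_prod_def sum_upt_2 less_2_cases_iff)
    then show ?thesis using g star.act_eq_iff[OF g star_rep_tuples star_rep_tuples] by metis
  qed
  ultimately have "deg_le star star_dim (star_rep 0 1 (-1) 0) (?c 0)"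
    by (rule deg_le_curve) (use star_rep_tuples in auto)
  then show ?thesis by simp
qed

text \<open>
  The two lines spanned by the maps \<open>1 \<rightarrow> 0\<close> and \<open>2 \<rightarrow> 0\<close> stay isotropic and distinct along the
  orbit of the isometry group. A hyperbolic plane has only two isotropic lines, so the product of
  the first coordinates of the two spanning vectors vanishes on the orbit.
\<close>

lemma star_not_sym_deg_le:
  "\<not> sym_deg_le star star_dim star_form (star_rep 0 1 (-1) 0) (star_rep 1 0 0 (-1))"
proof -
  let ?M = "star_rep 0 1 (-1) 0"
  \<comment> \<open>At the proposed limit both lines are spanned by (1, 0), so the value there is
    1.\<close>
  let ?f = "\<lambda>X. X 1 $$ (0, 0) * X 2 $$ (0, 0) :: complex"
  let ?Z = "{X \<in> rep_tuples star star_dim. \<forall>f\<in>{?f}. f X = 0}"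
  have "?f \<in> poly_functions star star_dim"
    using poly_functions.coord[of 1 star 0 star_dim 0] poly_functions.coord[of 2 star 0 star_dim 0]
    by (intro poly_functions.mult) simp_all
  then have "zariski_closed star star_dim ?Z" unfolding zariski_closed_def by blast
  moreover have "(\<lambda>g. act star star_dim g ?M) ` G_bullet star star_dim star_form \<subseteq> ?Z"
  proof clarify
    fix g assume "g \<in> G_bullet star star_dim star_form"
    then have g: "g \<in> GL_bullet star star_dim" and
      iso: "\<And>i k j l. star_form (graded_apply star g (star_unit i k)) (graded_apply star g (star_unit j l)) =
        star_form (star_unit i k) (star_unit j l)"
      using star_unit_space by (auto simp: G_bullet_def)
    define X where "X = act star star_dim g ?M"
    have X: "X \<in> rep_tuples star star_dim"
      unfolding X_def by (rule star.act_rep_tuples[OF g star_rep_tuples])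
    have gX: "g (head star a) * ?M a = X a * g (tail star a)" if "a \<in> arcs star" for a
      using star.act_eq_iff[OF g star_rep_tuples X] that X_def by blast
    have gc: "g 0 \<in> carrier_mat 2 2" "g 1 \<in> carrier_mat 1 1" "g 2 \<in> carrier_mat 1 1" "g 3 \<in> carrier_mat 1 1" "g 4 \<in> carrier_mat 1 1"
      using GL_bullet_carrier[OF g, of 0] GL_bullet_carrier[OF g, of 1] GL_bullet_carrier[OF g, of 2]
        GL_bullet_carrier[OF g, of 3] GL_bullet_carrier[OF g, of 4] by auto
    have Xc: "X 1 \<in> carrier_mat 2 1" "X 2 \<in> carrier_mat 2 1"
      using rep_tuples_carrier[OF X, of 1] rep_tuples_carrier[OF X, of 2] by auto
    have g12: "g i $$ (0, 0) \<noteq> 0" if i: "i = 1 \<or> i = 2" for i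
    proof -
      have ui: "g i \<in> Units (mat_ring 1)" using GL_bullet_Units[OF g, of i] i by auto
      then obtain h where h: "g i \<in> carrier_mat 1 1" "h \<in> carrier_mat 1 1" "g i * h = 1\<^sub>m 1"
        unfolding Units_mat_ring by blast
      have "(g i * h) $$ (0, 0) = 1" unfolding h(3) by simp
      then show ?thesis using h(1,2) by (auto simp: scalar_prod_def)
    qed
    let ?g = "\<lambda>i j. g 0 $$ (i, j)"
    have "(g 0 * ?M 1) $$ (0, 0) = (X 1 * g 1) $$ (0, 0)" "(g 0 * ?M 2) $$ (0, 0) = (X 2 * g 2) $$ (0, 0)"
      using gX[of 1] gX[of 2] by simp_all
    \<comment> \<open>The columns of \<open>g 0\<close> are the images of the two spanning vectors;
      they agree with the columns of \<open>X\<close> up to the nonzero scalars at 1 and 2.\<close>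
    then have 12: "?g 0 0 = X 1 $$ (0, 0) * g 1 $$ (0, 0)" "?g 0 1 = X 2 $$ (0, 0) * g 2 $$ (0, 0)"
      using gc Xc by (simp_all add: scalar_prod_def sum_upt_2)
    \<comment> \<open>Isometry on the central unit vectors: both columns are isotropic and pair to
      1. If both first coordinates were nonzero, isotropy would kill both second coordinates and
      with them the pairing.\<close>
    have *: "?g 0 0 * ?g 1 0 = 0" "?g 0 1 * ?g 1 1 = 0" "?g 0 0 * ?g 1 1 + ?g 1 0 * ?g 0 1 = 1"
      using iso[of 0 0 0 0] iso[of 0 1 0 1] iso[of 0 0 0 1] gc
      by (simp_all add: star_form_def graded_apply_def star_unit_def scalar_prod_def sum_upt_2)
    have "?g 0 0 = 0 \<or> ?g 0 1 = 0"
    proof (rule ccontr)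
      assume "\<not> ?thesis"
      then have "?g 1 0 = 0" "?g 1 1 = 0" using * by auto
      then show False using *(3) by simp
    qed
    then have "?f X = 0" using 12 g12[of 1] g12[of 2] by auto
    then show "act star star_dim g ?M \<in> rep_tuples star star_dim \<and> (\<forall>f\<in>{?f}. f (act star star_dim g ?M) = 0)"
      using X unfolding X_def by blast
  qed
  ultimately have "zariski_closed star star_dim hull ((\<lambda>g. act star star_dim g ?M) ` G_bullet star star_dim star_form) \<subseteq> ?Z"
    by (intro hull_minimal)
  moreover have "star_rep 1 0 0 (-1) \<notin> ?Z" by simp
  ultimately show ?thesis unfolding sym_deg_le_def by (rule contra_subsetD)
qed

theorem corollary4p3:
  shows "\<exists>(Q :: (nat, nat) pre_digraph) (I :: ((nat, nat) path \<Rightarrow> complex) set)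
           (\<sigma>0 :: nat \<Rightarrow> nat) (\<sigma>1 :: nat \<Rightarrow> nat) (\<epsilon> :: complex) (d :: nat \<Rightarrow> nat) (B :: nat form)
           (M :: nat \<Rightarrow> complex mat) (N :: nat \<Rightarrow> complex mat).
           symmetric_quiver_algebra Q I \<sigma>0 \<sigma>1 \<and>
           finite_rep_type Q I \<and>
           \<epsilon> \<in> {1, -1} \<and>
           quadratic_space Q \<sigma>0 d \<epsilon> B \<and>
           M \<in> symmetric_rep_variety Q I d B \<and>
           N \<in> symmetric_rep_variety Q I d B \<and>
           deg_le Q d M N \<and>
           \<not> sym_deg_le Q d B M N"
proof -
  have "star_rep 0 1 (-1) 0 \<in> symmetric_rep_variety star star_ideal star_dim star_form"
    "star_rep 1 0 0 (-1) \<in> symmetric_rep_variety star star_ideal star_dim star_form"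
    using star_rep_symmetric[of 0 1] star_rep_symmetric[of 1 0] by simp_all
  then show ?thesis
    using symmetric_quiver_algebra_star finite_rep_type_star quadratic_space_star star_deg_le
      star_not_sym_deg_le by blast
qed

end
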